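(* Let $T:[0,1]\to[0,1]$ be a nonsingular Borel map, let $\rho\in BV[-1,1]$ be a symmetric probability density on $[-1,1]$, and let $L:BV[0,1]\to BV[0,1]$ be the transfer operator of the system with additive noise $x_{n+1}=T(x_n)\hat+\Omega_n$, with $\Omega_n$ i.i.d. distributed according to $\rho$. Suppose $L$ has convergence to equilibrium with $BV$ and $L^1$ as strong and weak space, i.e. $\lim_{n\to\infty}\|L^ng\|_1=0$ for each $g\in BV[0,1]$ with $\int g\,dm=0$. Then $L:BV[0,1]\to BV[0,1]$ has spectral gap.
   Context: $m$ is Lebesgue measure; $T$ is nonsingular if $m(T^{-1}(A))=0\iff m(A)=0$. Symmetric: $\rho(x)=\rho(-x)$. Reflecting boundary sum: $a\hat+b:=\pi(a+b)$, where $\pi:\mathbb R\to[0,1]$, $\pi(x)=\min_{i\in\mathbb Z}|x-2i|$. The transfer operator is $L\nu=\pi_*[\mu_\rho*L_T\nu]$, where $L_T\nu(A)=\nu(T^{-1}(A))$, $\mu_\rho=\rho\,m$, $*$ is convolution of measures on $\mathbb R$ and $\pi_*$ is the pushforward by $\pi$; measures with density are identified with their densities. $Var(\phi)=\sup\sum_i|\phi(x_i)-\phi(x_{i+1})|$ over finite increasing sequences of points (for an a.e. class, the infimum over representatives), $\|\phi\|_{BV}=Var(\phi)+\|\phi\|_1$; $BV[0,1]$ is taken complex valued. An operator $L:B\to B$ on a complex Banach space has spectral gap if $L=\lambda P+N$ with $\lambda\in\mathbb C$ and $P,N$ bounded operators, $P^2=P$, $\dim(\mathrm{Im}\,P)=1$,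 the spectral radius of $N$ satisfies $\rho(N)<|\lambda|$, and $PN=NP=0$. *)

theory Defs
  imports "HOL-Analysis.Analysis"
begin

class complex_normed_vector = real_normed_vector +
  fixes scaleC :: "complex \<Rightarrow> 'a \<Rightarrow> 'a"  (infixr \<open>*\<^sub>C\<close> 75)
  assumes scaleC_add_right: "c *\<^sub>C (x + y) = c *\<^sub>C x + c *\<^sub>C y"
    and scaleC_add_left: "(c + d) *\<^sub>C x = c *\<^sub>C x + d *\<^sub>C x"
    and scaleC_scaleC: "c *\<^sub>C d *\<^sub>C x = (c * d) *\<^sub>C x"
    and scaleC_of_real: "complex_of_real r *\<^sub>C x = r *\<^sub>R x"
    and norm_scaleC: "norm (c *\<^sub>C x) = cmod c * norm x"

class complex_banach = complex_normed_vector + complete_space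

global_interpretation complex_vector:
  vector_space "scaleC :: complex \<Rightarrow> 'a \<Rightarrow> 'a::complex_normed_vector"
proof
  fix x :: 'a
  show "1 *\<^sub>C x = x" using scaleC_of_real[of 1 x] by simp
qed (simp_all add: scaleC_add_right scaleC_add_left scaleC_scaleC)

definition bounded_clinear :: "('a::complex_normed_vector \<Rightarrow> 'b::complex_normed_vector) \<Rightarrow> bool" where
  "bounded_clinear A \<longleftrightarrow> bounded_linear A \<and> (\<forall>c x. A (c *\<^sub>C x) = c *\<^sub>C A x)"

definition spectrum :: "('a::complex_banach \<Rightarrow> 'a) \<Rightarrow> complex set" where
  "spectrum A = {z. \<not> (\<exists>R. bounded_clinear R \<and>
      (\<forall>x. R (z *\<^sub>C x - A x) = x) \<and> (\<forall>x. z *\<^sub>C R x - A (R x) = x))}"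

text \<open>
  The supremum is taken in \<^typ>\<open>ennreal\<close>, because the real-valued supremum operator is
  unspecified on empty or unbounded sets.
\<close>

definition spectral_radius :: "('a::complex_banach \<Rightarrow> 'a) \<Rightarrow> ennreal" where
  "spectral_radius A = (SUP z\<in>spectrum A. ennreal (cmod z))"

definition has_spectral_gap :: "('a::complex_banach \<Rightarrow> 'a) \<Rightarrow> bool" where
  "has_spectral_gap L \<longleftrightarrow> (\<exists>lambda P N.
      bounded_clinear P \<and> bounded_clinear N \<and>
      (\<forall>x. L x = lambda *\<^sub>C P x + N x) \<and>
      P \<circ> P = P \<and> complex_vector.dim (range P) = 1 \<and>
      spectral_radius N < ennreal (cmod lambda) \<and>
      P \<circ> N = (\<lambda>x. 0) \<and> N \<circ> P = (\<lambda>x. 0))"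

abbreviation leb :: "real set \<Rightarrow> real measure" where
  "leb S \<equiv> restrict_space lborel S"

definition variation :: "real set \<Rightarrow> (real \<Rightarrow> 'a::real_normed_vector) \<Rightarrow> ennreal" where
  "variation S f =
     (SUP (n, x) \<in> {(n, x :: nat \<Rightarrow> real). (\<forall>i\<le>n. x i \<in> S) \<and> (\<forall>i<n. x i < x (Suc i))}.
        \<Sum>i<n. ennreal (norm (f (x i) - f (x (Suc i)))))"

text \<open>
  The variation of the a.e. class of \<open>f\<close>; representatives are Borel functions on \<open>S\<close>.
\<close>

definition ess_variation :: "real set \<Rightarrow> (real \<Rightarrow> 'a::real_normed_vector) \<Rightarrow> ennreal" where
  "ess_variation S f =
     (INF g \<in> {g \<in> borel_measurable (leb S). AE x in leb S. g x = f x}. variation S g)"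

definition BV_fun :: "real set \<Rightarrow> (real \<Rightarrow> 'a::{banach, second_countable_topology}) \<Rightarrow> bool" where
  "BV_fun S f \<longleftrightarrow> integrable (leb S) f \<and> ess_variation S f < top"

definition BV_norm :: "real set \<Rightarrow> (real \<Rightarrow> 'a::{banach, second_countable_topology}) \<Rightarrow> real" where
  "BV_norm S f = enn2real (ess_variation S f) + (\<integral>x. norm (f x) \<partial>leb S)"

lemma variation_le_iff:
  "variation S f \<le> B \<longleftrightarrow> (\<forall>n x. (\<forall>i\<le>n. x i \<in> S) \<longrightarrow> (\<forall>i<n. x i < x (Suc i)) \<longrightarrow>
     (\<Sum>i<n. ennreal (norm (f (x i) - f (x (Suc i))))) \<le> B)"
  unfolding variation_def SUP_le_iff by auto

lemma variation_sumD:
  assumes "\<forall>i\<le>n. x i \<in> S" "\<forall>i<n. x i < x (Suc i)"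
  shows "(\<Sum>i<n. ennreal (norm (f (x i) - f (x (Suc i))))) \<le> variation S f"
  using assms variation_le_iff[of S f "variation S f"] by blast

lemma variation_add: "variation S (\<lambda>x. f x + g x) \<le> variation S f + variation S g"
  unfolding variation_le_iff
proof (intro allI impI)
  fix n and x :: "nat \<Rightarrow> real"
  assume x: "\<forall>i\<le>n. x i \<in> S" "\<forall>i<n. x i < x (Suc i)"
  have "(\<Sum>i<n. ennreal (norm (f (x i) + g (x i) - (f (x (Suc i)) + g (x (Suc i))))))
    \<le> (\<Sum>i<n. ennreal (norm (f (x i) - f (x (Suc i)))) + ennreal (norm (g (x i) - g (x (Suc i)))))"
    by (intro sum_mono) (simp flip: ennreal_plus add: norm_diff_triangle_ineq ennreal_leI)
  also have "\<dots> \<le> variation S f + variation S g"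
    unfolding sum.distrib by (intro add_mono variation_sumD x)
  finally show "(\<Sum>i<n. ennreal (norm (f (x i) + g (x i) - (f (x (Suc i)) + g (x (Suc i)))))) \<le> \<dots>" .
qed

lemma variation_mult:
  fixes f :: "real \<Rightarrow> complex"
  shows "variation S (\<lambda>x. c * f x) \<le> ennreal (cmod c) * variation S f"
  unfolding variation_le_iff
proof (intro allI impI)
  fix n and x :: "nat \<Rightarrow> real"
  assume x: "\<forall>i\<le>n. x i \<in> S" "\<forall>i<n. x i < x (Suc i)"
  have "(\<Sum>i<n. ennreal (norm (c * f (x i) - c * f (x (Suc i)))))
    = ennreal (cmod c) * (\<Sum>i<n. ennreal (norm (f (x i) - f (x (Suc i)))))"
    unfolding sum_distrib_left
    by (intro sum.cong refl) (simp flip: ennreal_mult right_diff_distrib add: norm_mult)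
  also have "\<dots> \<le> ennreal (cmod c) * variation S f"
    by (intro mult_left_mono variation_sumD x) auto
  finally show "(\<Sum>i<n. ennreal (norm (c * f (x i) - c * f (x (Suc i))))) \<le> \<dots>" .
qed

lemma variation_lim:
  assumes "\<And>n. variation S (s n) \<le> B" "\<And>x. x \<in> S \<Longrightarrow> (\<lambda>n. s n x) \<longlonglongrightarrow> f x"
  shows "variation S f \<le> B"
  unfolding variation_le_iff
proof (intro allI impI)
  fix n and x :: "nat \<Rightarrow> real"
  assume x: "\<forall>i\<le>n. x i \<in> S" "\<forall>i<n. x i < x (Suc i)"
  have "(\<lambda>k. \<Sum>i<n. ennreal (norm (s k (x i) - s k (x (Suc i)))))
      \<longlonglongrightarrow> (\<Sum>i<n. ennreal (norm (f (x i) - f (x (Suc i)))))"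
    using x by (intro tendsto_sum tendsto_ennrealI tendsto_norm tendsto_diff assms(2)) auto
  then show "(\<Sum>i<n. ennreal (norm (f (x i) - f (x (Suc i))))) \<le> B"
    by (rule LIMSEQ_le_const2) (use variation_sumD[OF x] assms(1) order_trans in blast)
qed

lemma ess_variation_cong:
  assumes "AE x in leb S. f x = g x"
  shows "ess_variation S f = ess_variation S g"
proof -
  have "(AE x in leb S. h x = f x) \<longleftrightarrow> (AE x in leb S. h x = g x)" for h :: "real \<Rightarrow> 'a"
    by (rule eventually_subst) (use assms in eventually_elim, simp)
  then show ?thesis unfolding ess_variation_def by simp
qed

lemma ess_variation_le:
  "g \<in> borel_measurable (leb S) \<Longrightarrow> AE x in leb S. g x = f x \<Longrightarrow> ess_variation S f \<le> variation S g"
  unfolding ess_variation_def by (rule INF_lower) simp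

lemma ess_variation_less:
  assumes "ess_variation S f < B"
  obtains g where "g \<in> borel_measurable (leb S)" "AE x in leb S. g x = f x" "variation S g < B"
  using assms unfolding ess_variation_def INF_less_iff by auto

lemma ess_variation_add:
  fixes f g :: "real \<Rightarrow> 'a::{real_normed_vector, second_countable_topology}"
  shows "ess_variation S (\<lambda>x. f x + g x) \<le> ess_variation S f + ess_variation S g"
proof (rule ennreal_le_epsilon)
  fix e :: real assume fin: "ess_variation S f + ess_variation S g < top" and e: "0 < e"
  have "ess_variation S h < ess_variation S h + ennreal (e / 2)" if "ess_variation S h < top"
    for h :: "real \<Rightarrow> 'a"
    using that e by (cases "ess_variation S h" rule: ennreal_cases)
      (auto simp flip: ennreal_plus simp: ennreal_less_iff)
  then have lt: "ess_variation S f < ess_variation S f + ennreal (e / 2)"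
      "ess_variation S g < ess_variation S g + ennreal (e / 2)"
    using fin by (blast dest: ennreal_add_less_top[THEN iffD1])+
  obtain f' where f': "f' \<in> borel_measurable (leb S)" "AE x in leb S. f' x = f x"
      "variation S f' < ess_variation S f + ennreal (e/2)"
    by (rule ess_variation_less[OF lt(1)])
  obtain g' where g': "g' \<in> borel_measurable (leb S)" "AE x in leb S. g' x = g x"
      "variation S g' < ess_variation S g + ennreal (e/2)"
    by (rule ess_variation_less[OF lt(2)])
  have "AE x in leb S. f' x + g' x = f x + g x"
    using f'(2) g'(2) by eventually_elim simp
  then have "ess_variation S (\<lambda>x. f x + g x) \<le> variation S (\<lambda>x. f' x + g' x)"
    using f'(1) g'(1) by (intro ess_variation_le) auto
  also have "\<dots> \<le> variation S f' + variation S g'" by (rule variation_add)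
  also have "\<dots> \<le> (ess_variation S f + ennreal (e/2)) + (ess_variation S g + ennreal (e/2))"
    using f' g' by (intro add_mono less_imp_le) auto
  also have "\<dots> = ess_variation S f + ess_variation S g + (ennreal (e/2) + ennreal (e/2))"
    by (simp add: ac_simps)
  also have "ennreal (e/2) + ennreal (e/2) = ennreal e"
    using e by (simp flip: ennreal_plus)
  finally show "ess_variation S (\<lambda>x. f x + g x) \<le> ess_variation S f + ess_variation S g + ennreal e" .
qed

lemma ess_variation_mult:
  fixes f :: "real \<Rightarrow> complex"
  shows "ess_variation S (\<lambda>x. c * f x) \<le> ennreal (cmod c) * ess_variation S f"
proof (cases "ess_variation S f = top \<and> c \<noteq> 0")
  case True
  then show ?thesis by (auto simp: ennreal_mult_top)
next
  case False
  show ?thesis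
  proof (cases "c = 0")
    case True
    have "ess_variation S (\<lambda>x. c * f x) \<le> variation S (\<lambda>x. 0 * f x)"
      using True by (intro ess_variation_le) auto
    also have "\<dots> \<le> 0" using variation_mult[of S 0 f] by simp
    finally show ?thesis by simp
  next
    case c: False
    have "ess_variation S (\<lambda>x. c * f x) \<le> ennreal (cmod c) * variation S g"
      if "g \<in> borel_measurable (leb S)" "AE x in leb S. g x = f x" for g
    proof -
      have "ess_variation S (\<lambda>x. c * f x) \<le> variation S (\<lambda>x. c * g x)"
        using that by (intro ess_variation_le) auto
      then show ?thesis using variation_mult order_trans by blast
    qed
    then have *: "ess_variation S (\<lambda>x. c * f x) / ennreal (cmod c) \<le> variation S g"
      if "g \<in> borel_measurable (leb S)" "AE x in leb S. g x = f x" for g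
      using that c by (subst divide_le_posI_ennreal) (auto simp: mult.commute)
    have "ess_variation S (\<lambda>x. c * f x) / ennreal (cmod c) \<le> ess_variation S f"
      unfolding ess_variation_def[of S f] by (rule INF_greatest) (use * in auto)
    then show ?thesis using c
      by (metis ennreal_eq_0_iff ennreal_mult_divide_eq mult_left_mono ennreal_times_divide
          ennreal_neq_top mult.commute norm_le_zero_iff zero_le)
  qed
qed

lemma BV_fun_cong:
  assumes "BV_fun S f" "g \<in> borel_measurable (leb S)" "AE x in leb S. f x = g x"
  shows "BV_fun S g"
proof -
  show ?thesis
    using assms(1) ess_variation_cong[OF assms(3)]
      integrable_cong_AE_imp[of "leb S" f g, OF _ assms(2,3)] by (auto simp: BV_fun_def)
qed

lemma BV_fun_of_variation:
  assumes "integrable (leb S) f" "variation S f < top"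
  shows "BV_fun S f"
  using assms le_less_trans[OF ess_variation_le[of f S f]] by (simp add: BV_fun_def borel_measurable_integrable)

lemma BV_fun_add:
  "BV_fun S f \<Longrightarrow> BV_fun S g \<Longrightarrow> BV_fun S (\<lambda>x. f x + g x)"
  unfolding BV_fun_def
  by (intro conjI Bochner_Integration.integrable_add le_less_trans[OF ess_variation_add]) auto

lemma BV_fun_mult:
  fixes f :: "real \<Rightarrow> complex"
  shows "BV_fun S f \<Longrightarrow> BV_fun S (\<lambda>x. c * f x)"
  unfolding BV_fun_def
  by (intro conjI integrable_mult_right le_less_trans[OF ess_variation_mult]) (auto simp: ennreal_mult_less_top)

lemma variation_zero: "variation S (\<lambda>x. 0) = 0"
  using variation_le_iff[of S "\<lambda>x. 0" 0] by (simp add: le_zero_eq)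

lemma BV_fun_zero: "BV_fun S (\<lambda>x. 0)"
  by (rule BV_fun_of_variation) (auto simp: variation_zero)

lemma BV_norm_add:
  assumes "BV_fun S f" "BV_fun S g"
  shows "BV_norm S (\<lambda>x. f x + g x) \<le> BV_norm S f + BV_norm S g"
proof -
  have "enn2real (ess_variation S (\<lambda>x. f x + g x)) \<le> enn2real (ess_variation S f + ess_variation S g)"
    using assms by (intro enn2real_mono ess_variation_add) (auto simp: BV_fun_def)
  also have "\<dots> = enn2real (ess_variation S f) + enn2real (ess_variation S g)"
    using assms by (intro enn2real_plus) (auto simp: BV_fun_def)
  finally have 1: "enn2real (ess_variation S (\<lambda>x. f x + g x)) \<le> \<dots>" .
  have "(\<integral>x. norm (f x + g x) \<partial>leb S) \<le> (\<integral>x. norm (f x) + norm (g x) \<partial>leb S)"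
    using assms unfolding BV_fun_def
    by (intro integral_mono integrable_norm Bochner_Integration.integrable_add norm_triangle_ineq) blast+
  also have "\<dots> = (\<integral>x. norm (f x) \<partial>leb S) + (\<integral>x. norm (g x) \<partial>leb S)"
    using assms by (intro Bochner_Integration.integral_add) (auto simp: BV_fun_def)
  finally show ?thesis using 1 by (simp add: BV_norm_def)
qed

lemma BV_norm_mult:
  fixes f :: "real \<Rightarrow> complex"
  assumes f: "BV_fun S f"
  shows "BV_norm S (\<lambda>x. c * f x) = cmod c * BV_norm S f"
proof -
  have le: "enn2real (ess_variation S (\<lambda>x. d * g x)) \<le> cmod d * enn2real (ess_variation S g)"
    if "BV_fun S g" for d and g :: "real \<Rightarrow> complex"
  proof -
    have "enn2real (ess_variation S (\<lambda>x. d * g x)) \<le> enn2real (ennreal (cmod d) * ess_variation S g)"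
      using that by (intro enn2real_mono ess_variation_mult) (auto simp: BV_fun_def ennreal_mult_less_top)
    then show ?thesis by (simp add: enn2real_mult)
  qed
  have "enn2real (ess_variation S (\<lambda>x. c * f x)) = cmod c * enn2real (ess_variation S f)"
  proof (cases "c = 0")
    case True
    then show ?thesis using le[OF f, of 0] by (simp add: enn2real_nonneg order_antisym)
  next
    case False
    have "enn2real (ess_variation S f) \<le> cmod (inverse c) * enn2real (ess_variation S (\<lambda>x. c * f x))"
      using le[OF BV_fun_mult[OF f, of c], of "inverse c"] False by (simp flip: mult.assoc)
    then have "cmod c * enn2real (ess_variation S f) \<le> enn2real (ess_variation S (\<lambda>x. c * f x))"
      using False by (simp add: norm_inverse norm_divide field_simps)
    then show ?thesis using le[OF f, of c] by linarith
  qed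
  then show ?thesis
    by (simp add: BV_norm_def norm_mult distrib_left)
qed

lemma BV_norm_cong:
  assumes "BV_fun S f" "BV_fun S g" "AE x in leb S. f x = g x"
  shows "BV_norm S f = BV_norm S g"
proof -
  have "(\<integral>x. norm (f x) \<partial>leb S) = (\<integral>x. norm (g x) \<partial>leb S)"
    using assms by (intro integral_cong_AE) (auto simp: BV_fun_def)
  then show ?thesis using ess_variation_cong[OF assms(3)] by (simp add: BV_norm_def)
qed

lemma BV_norm_eq_0_iff:
  fixes f :: "real \<Rightarrow> complex"
  assumes f: "BV_fun {0..1} f"
  shows "BV_norm {0..1} f = 0 \<longleftrightarrow> (AE x in leb {0..1}. f x = 0)"
proof
  show "AE x in leb {0..1}. f x = 0" if n: "BV_norm {0..1} f = 0"
  proof -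
    have "(\<integral>x. norm (f x) \<partial>leb {0..1}) = 0"
      using n by (simp add: BV_norm_def add_nonneg_eq_0_iff enn2real_nonneg)
    then show ?thesis
      using f by (subst (asm) integral_nonneg_eq_0_iff_AE) (auto simp: BV_fun_def)
  qed
next
  show "BV_norm {0..1} f = 0" if n: "AE x in leb {0..1}. f x = 0"
  proof -
    have "BV_norm {0..1} f = BV_norm {0..1} (\<lambda>x. 0 :: complex)"
      using f n by (intro BV_norm_cong BV_fun_zero)
    also have "\<dots> = 0"
      using ess_variation_le[of "\<lambda>x. 0::complex" "{0..1}" "\<lambda>x. 0"]
      by (simp add: BV_norm_def variation_zero)
    finally show ?thesis .
  qed
qed

text \<open>
  Elements are a.e. classes of functions on $[0,1]$; the values of a representative outside
  $[0,1]$ are irrelevant, since a.e. refers to Lebesgue measure on $[0,1]$.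
\<close>

quotient_type bv = "real \<Rightarrow> complex" / partial:
  "\<lambda>f g. BV_fun {0..1} f \<and> BV_fun {0..1} g \<and> (AE x in leb {0..1}. f x = g x)"
proof (rule part_equivpI)
  show "\<exists>f. BV_fun {0..1} f \<and> BV_fun {0..1} f \<and> (AE x in leb {0..1}. f x = (f x :: complex))"
    using BV_fun_zero by auto
  show "symp (\<lambda>f g :: real \<Rightarrow> complex. BV_fun {0..1} f \<and> BV_fun {0..1} g \<and> (AE x in leb {0..1}. f x = g x))"
    by (intro sympI) (simp add: eq_commute)
  show "transp (\<lambda>f g :: real \<Rightarrow> complex. BV_fun {0..1} f \<and> BV_fun {0..1} g \<and> (AE x in leb {0..1}. f x = g x))"
  proof (intro transpI)
    fix f g h :: "real \<Rightarrow> complex"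
    assume fg: "BV_fun {0..1} f \<and> BV_fun {0..1} g \<and> (AE x in leb {0..1}. f x = g x)"
      and gh: "BV_fun {0..1} g \<and> BV_fun {0..1} h \<and> (AE x in leb {0..1}. g x = h x)"
    have "AE x in leb {0..1}. f x = h x"
      using conjunct2[OF conjunct2[OF fg]] conjunct2[OF conjunct2[OF gh]] by eventually_elim simp
    then show "BV_fun {0..1} f \<and> BV_fun {0..1} h \<and> (AE x in leb {0..1}. f x = h x)"
      using fg gh by simp
  qed
qed

instantiation bv :: complex_normed_vector
begin

lift_definition zero_bv :: bv is "\<lambda>x. 0"
  by (simp add: BV_fun_zero)

lift_definition plus_bv :: "bv \<Rightarrow> bv \<Rightarrow> bv" is "\<lambda>f g x. f x + g x"
  by (auto simp: BV_fun_add)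

lift_definition scaleC_bv :: "complex \<Rightarrow> bv \<Rightarrow> bv" is "\<lambda>c f x. c * f x"
  by (auto simp: BV_fun_mult)

definition scaleR_bv :: "real \<Rightarrow> bv \<Rightarrow> bv" where
  "scaleR_bv r x = scaleC (complex_of_real r) x"

definition uminus_bv :: "bv \<Rightarrow> bv" where
  "uminus_bv x = scaleC (- 1) x"

definition minus_bv :: "bv \<Rightarrow> bv \<Rightarrow> bv" where
  "minus_bv x y = x + (- y :: bv)"

lift_definition norm_bv :: "bv \<Rightarrow> real" is "BV_norm {0..1}"
  by (auto intro: BV_norm_cong)

definition dist_bv :: "bv \<Rightarrow> bv \<Rightarrow> real" where
  "dist_bv x y = norm (x - y)"

definition sgn_bv :: "bv \<Rightarrow> bv" where
  "sgn_bv x = scaleR (inverse (norm x)) x"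

definition uniformity_bv :: "(bv \<times> bv) filter" where
  "uniformity_bv = (INF e\<in>{0<..}. principal {(x, y). dist x y < e})"

definition open_bv :: "bv set \<Rightarrow> bool" where
  "open_bv U = (\<forall>x\<in>U. eventually (\<lambda>(x', y). x' = x \<longrightarrow> y \<in> U) uniformity)"

instance
proof
  fix x y z :: bv and a b :: real and c d :: complex and U :: "bv set"
  show "x + y + z = x + (y + z)"
    by transfer (auto simp: add.assoc BV_fun_add)
  show "x + y = y + x"
    by transfer (auto simp: add.commute BV_fun_add)
  show "0 + x = x"
    by transfer (auto simp: BV_fun_zero)
  show "- x + x = 0"
    unfolding uminus_bv_def by transfer (auto simp: BV_fun_zero BV_fun_add BV_fun_mult[of _ _ "-1", simplified])
  show "x - y = x + - y" by (simp add: minus_bv_def)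
  show 1: "c *\<^sub>C (x + y) = c *\<^sub>C x + c *\<^sub>C y" for c :: complex and x y :: bv
    by transfer (auto simp: distrib_left BV_fun_add BV_fun_mult)
  show 2: "(c + d) *\<^sub>C x = c *\<^sub>C x + d *\<^sub>C x" for c d :: complex and x :: bv
    by transfer (auto simp: distrib_right BV_fun_add BV_fun_mult)
  show 3: "c *\<^sub>C d *\<^sub>C x = (c * d) *\<^sub>C x" for c d :: complex and x :: bv
    by transfer (auto simp: mult.assoc BV_fun_mult)
  show "complex_of_real a *\<^sub>C x = a *\<^sub>R x" by (simp add: scaleR_bv_def)
  show "a *\<^sub>R (x + y) = a *\<^sub>R x + a *\<^sub>R y" by (simp add: scaleR_bv_def 1)
  show "(a + b) *\<^sub>R x = a *\<^sub>R x + b *\<^sub>R x" by (simp add: scaleR_bv_def 2)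
  show "a *\<^sub>R b *\<^sub>R x = (a * b) *\<^sub>R x" by (simp add: scaleR_bv_def 3)
  show "1 *\<^sub>R x = x" unfolding scaleR_bv_def by transfer auto
  show 4: "norm (c *\<^sub>C x) = cmod c * norm x" for c :: complex and x :: bv
    by transfer (auto simp: BV_norm_mult)
  show "norm (a *\<^sub>R x) = \<bar>a\<bar> * norm x" by (simp add: scaleR_bv_def 4)
  show "norm (x + y) \<le> norm x + norm y" by transfer (auto simp: BV_norm_add)
  show "norm x = 0 \<longleftrightarrow> x = 0"
    by transfer (auto simp: BV_norm_eq_0_iff BV_fun_zero)
  show "dist x y = norm (x - y)" by (rule dist_bv_def)
  show "sgn x = inverse (norm x) *\<^sub>R x" by (simp add: sgn_bv_def)
  show "uniformity = (INF e\<in>{0<..}. principal {(x, y :: bv). dist x y < e})" by (rule uniformity_bv_def)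
  show "open U = (\<forall>x\<in>U. eventually (\<lambda>(x', y). x' = x \<longrightarrow> y \<in> U) uniformity)" by (rule open_bv_def)
qed

end

lemma measure_leb01: "finite_measure (leb {0..1})" "measure (leb {0..1}) {0..1} = 1"
  by (auto intro!: finite_measureI simp: space_restrict_space emeasure_restrict_space measure_restrict_space)

lemma norm_le_variation:
  fixes f :: "real \<Rightarrow> complex"
  assumes "integrable (leb {0..1}) f" "variation {0..1} f \<le> ennreal V" "0 \<le> V" "x \<in> {0..1}"
  shows "norm (f x) \<le> V + (\<integral>y. norm (f y) \<partial>leb {0..1})"
proof -
  interpret finite_measure "leb {0..1}" by (rule measure_leb01)
  have *: "norm (f a - f b) \<le> V" if "a \<in> {0..1}" "b \<in> {0..1}" "a < b" for a b
  proof -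
    have "(\<Sum>i<Suc 0. ennreal (norm (f ((\<lambda>i. if i = 0 then a else b) i)
        - f ((\<lambda>i. if i = 0 then a else b) (Suc i))))) \<le> variation {0..1} f"
      using that by (intro variation_sumD) (auto simp: le_Suc_eq)
    then have "ennreal (norm (f a - f b)) \<le> ennreal V" using assms(2) by simp
    then show ?thesis using assms(3) by (simp add: ennreal_le_iff)
  qed
  have "norm (f x) - V \<le> norm (f y)" if "y \<in> {0..1}" for y
  proof (cases x y rule: linorder_cases)
    case less
    then show ?thesis using *[of x y] assms(4) that norm_triangle_ineq2[of "f x" "f y"] by linarith
  next
    case equal
    then show ?thesis using assms(3) by simp
  next
    case greater
    then show ?thesis using *[of y x] assms(4) that norm_triangle_ineq2[of "f x" "f y"]
      by (simp add: norm_minus_commute)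
  qed
  moreover have "integrable (leb {0..1}) (\<lambda>y. norm (f y))"
    using assms(1) by (rule Bochner_Integration.integrable_norm)
  ultimately have "(\<integral>y. norm (f x) - V \<partial>leb {0..1}) \<le> (\<integral>y. norm (f y) \<partial>leb {0..1})"
    by (intro integral_mono) (auto simp: space_restrict_space)
  then show ?thesis using measure_leb01(2) by (simp add: space_restrict_space)
qed

lemma bv_abs_eqI:
  "BV_fun {0..1} f \<Longrightarrow> BV_fun {0..1} g \<Longrightarrow> AE x in leb {0..1}. f x = g x \<Longrightarrow> abs_bv f = abs_bv g"
  using Quotient_rel_abs[OF Quotient_bv, of f g] by simp

lemma bv_representative:
  fixes b :: bv and e :: real
  assumes "0 < e"
  obtains g where "BV_fun {0..1} g" "abs_bv g = b" "variation {0..1} g \<le> ennreal (norm b + e)"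
    "(\<integral>x. norm (g x) \<partial>leb {0..1}) \<le> norm b"
proof -
  obtain f where f: "BV_fun {0..1} f" "b = abs_bv f"
    using Quotient_rep_reflp[OF Quotient_bv, of b] Quotient_abs_rep[OF Quotient_bv, of b] by metis
  have nb: "norm b = BV_norm {0..1} f"
    using f by (simp add: norm_bv.abs_eq)
  have E: "ess_variation {0..1} f = ennreal (enn2real (ess_variation {0..1} f))"
    using f by (simp add: BV_fun_def less_top)
  also have "\<dots> < ennreal (norm b + e)"
    using assms nb by (intro ennreal_lessI) (auto simp: BV_norm_def add_nonneg_pos add_strict_increasing2 add_nonneg_nonneg enn2real_nonneg)
  finally obtain g where gm: "g \<in> borel_measurable (leb {0..1})"
    and g: "AE x in leb {0..1}. g x = f x" "variation {0..1} g < ennreal (norm b + e)"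
    by (rule ess_variation_less)
  have ae: "AE x in leb {0..1}. f x = g x" using g(1) by eventually_elim simp
  have gB: "BV_fun {0..1} g" by (rule BV_fun_cong[OF f(1) gm ae])
  show ?thesis
  proof
    show "BV_fun {0..1} g" by fact
    show "abs_bv g = b" using f gB ae by (metis bv_abs_eqI)
    show "variation {0..1} g \<le> ennreal (norm b + e)" using g by simp
    have "(\<integral>x. norm (g x) \<partial>leb {0..1}) = (\<integral>x. norm (f x) \<partial>leb {0..1})"
      using f(1) gB ae by (intro integral_cong_AE) (auto simp: BV_fun_def)
    then show "(\<integral>x. norm (g x) \<partial>leb {0..1}) \<le> norm b"
      by (simp add: nb BV_norm_def)
  qed
qed

lemma bv_abs_add:
  assumes "BV_fun {0..1} f" "BV_fun {0..1} g"
  shows "abs_bv (\<lambda>x. f x + g x) = abs_bv f + abs_bv g"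
  using assms by (simp add: plus_bv.abs_eq)

lemma bv_norm_le:
  assumes "integrable (leb {0..1}) f" "variation {0..1} f \<le> ennreal V" "0 \<le> V"
    "\<And>x. x \<in> {0..1} \<Longrightarrow> norm (f x) \<le> K"
  shows "norm (abs_bv f) \<le> V + K"
proof -
  interpret finite_measure "leb {0..1}" by (rule measure_leb01)
  have f: "BV_fun {0..1} f"
    using assms by (intro BV_fun_of_variation) (auto intro: le_less_trans)
  have "ess_variation {0..1} f \<le> ennreal V"
    using assms by (intro order_trans[OF ess_variation_le]) auto
  then have "enn2real (ess_variation {0..1} f) \<le> V"
    using assms(3) by (rule enn2real_leI[rotated])
  moreover have "(\<integral>x. norm (f x) \<partial>leb {0..1}) \<le> (\<integral>x. K \<partial>leb {0..1})"
    using assms by (intro integral_mono) (auto simp: space_restrict_space)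
  ultimately show ?thesis
    using f measure_leb01(2) by (simp add: norm_bv.abs_eq BV_norm_def space_restrict_space)
qed

lemma bv_geometric_sum:
  fixes d :: "nat \<Rightarrow> bv"
  assumes d: "\<And>k. norm (d k) \<le> (1/2) ^ k"
  obtains t :: "nat \<Rightarrow> bv" where "\<And>n. t n = d n + t (Suc n)" "\<And>n. norm (t n) \<le> 10 * (1/2) ^ n"
proof -
  have "\<exists>g. BV_fun {0..1} g \<and> abs_bv g = d k \<and> variation {0..1} g \<le> ennreal (2 * (1/2) ^ k)
      \<and> (\<integral>x. norm (g x) \<partial>leb {0..1}) \<le> (1/2) ^ k" for k
  proof -
    obtain g where g: "BV_fun {0..1} g" "abs_bv g = d k"
      "variation {0..1} g \<le> ennreal (norm (d k) + (1/2) ^ k)"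
      "(\<integral>x. norm (g x) \<partial>leb {0..1}) \<le> norm (d k)"
      by (rule bv_representative[of "(1/2) ^ k" "d k"]) auto
    have "ennreal (norm (d k) + (1/2) ^ k) \<le> ennreal (2 * (1/2) ^ k)"
      using d[of k] by (intro ennreal_leI) simp
    with g d[of k] show ?thesis by (intro exI[of _ g]) (auto intro: order_trans)
  qed
  then obtain g where g: "\<And>k. BV_fun {0..1} (g k)" "\<And>k. abs_bv (g k) = d k"
    "\<And>k. variation {0..1} (g k) \<le> ennreal (2 * (1/2) ^ k)"
    "\<And>k. (\<integral>x. norm (g k x) \<partial>leb {0..1}) \<le> (1/2) ^ k"
    by metis
  have gi: "integrable (leb {0..1}) (g k)" for k
    using g(1) by (simp add: BV_fun_def)
  have bd: "norm (g k x) \<le> 3 * (1/2) ^ k" if "x \<in> {0..1}" for k x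
    using norm_le_variation[OF gi g(3) _ that, of k] g(4)[of k] by simp
  have geo: "(\<lambda>k. c * (1/2) ^ (k + n)) sums (2 * c * (1/2) ^ n)" for c :: real and n
  proof -
    have "(\<lambda>k. c * (1/2) ^ n * (1/2) ^ k) sums (c * (1/2) ^ n * (1 / (1 - 1/2)))"
      by (intro sums_mult geometric_sums) simp
    then show ?thesis by (simp add: power_add ac_simps)
  qed
  have su: "summable (\<lambda>k. norm (g (k + n) x))" if "x \<in> {0..1}" for n x
    by (rule summable_comparison_test'[OF sums_summable[OF geo[of 3 n]]]) (use bd[OF that] in simp)
  have su': "summable (\<lambda>k. g (k + n) x)" if "x \<in> {0..1}" for n x
    using su[OF that] by (rule summable_norm_cancel)
  define s where "s n x = (\<Sum>k. g (k + n) x)" for n x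
  have s_bd: "norm (s n x) \<le> 6 * (1/2) ^ n" if "x \<in> {0..1}" for n x
  proof -
    have "norm (s n x) \<le> (\<Sum>k. norm (g (k + n) x))"
      unfolding s_def by (rule summable_norm[OF su[OF that]])
    also have "\<dots> \<le> (\<Sum>k. 3 * (1/2) ^ (k + n))"
      by (intro suminf_le su that bd sums_summable[OF geo])
    also have "\<dots> = 6 * (1/2) ^ n" using sums_unique[OF geo[of 3 n]] by simp
    finally show ?thesis .
  qed
  have s_lim: "(\<lambda>N. \<Sum>k<N. g (k + n) x) \<longlonglongrightarrow> s n x" if "x \<in> {0..1}" for n x
    unfolding s_def by (rule summable_LIMSEQ[OF su'[OF that]])
  have [measurable]: "g k \<in> borel_measurable (leb {0..1})" for k
    using gi by auto
  have s_meas: "s n \<in> borel_measurable (leb {0..1})" for n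
    by (rule borel_measurable_LIMSEQ_metric[of "\<lambda>N x. \<Sum>k<N. g (k + n) x"])
      (use s_lim in \<open>auto simp: space_restrict_space\<close>)
  interpret finite_measure "leb {0..1}" by (rule measure_leb01)
  have s_int: "integrable (leb {0..1}) (s n)" for n
    using s_bd by (intro integrable_const_bound[where B = "6 * (1/2) ^ n"] s_meas AE_I2)
      (auto simp: space_restrict_space)
  have part: "variation {0..1} (\<lambda>x. \<Sum>k<N. g (k + n) x) \<le> (\<Sum>k<N. ennreal (2 * (1/2) ^ (k + n)))" for N n
  proof (induction N)
    case 0
    then show ?case by (simp add: variation_zero)
  next
    case (Suc N)
    have "variation {0..1} (\<lambda>x. (\<Sum>k<N. g (k + n) x) + g (N + n) x)
        \<le> variation {0..1} (\<lambda>x. \<Sum>k<N. g (k + n) x) + variation {0..1} (g (N + n))"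
      by (rule variation_add)
    also have "\<dots> \<le> (\<Sum>k<N. ennreal (2 * (1/2) ^ (k + n))) + ennreal (2 * (1/2) ^ (N + n))"
      by (intro add_mono Suc.IH g(3))
    finally show ?case by simp
  qed
  have s_var: "variation {0..1} (s n) \<le> ennreal (4 * (1/2) ^ n)" for n
  proof (rule variation_lim[OF _ s_lim])
    fix N
    have "(\<Sum>k<N. 2 * (1/2) ^ (k + n)) \<le> (\<Sum>k. 2 * (1/2 :: real) ^ (k + n))"
      by (intro sum_le_suminf sums_summable[OF geo]) auto
    also have "\<dots> = 4 * (1/2) ^ n" using sums_unique[OF geo[of 2 n]] by simp
    finally show "variation {0..1} (\<lambda>x. \<Sum>k<N. g (k + n) x) \<le> ennreal (4 * (1/2) ^ n)"
      using part[where N = N and n = n] by (simp add: sum_ennreal) (meson ennreal_leI order_trans)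
  qed
  have s_BV: "BV_fun {0..1} (s n)" for n
    using s_int s_var[of n] by (intro BV_fun_of_variation) (auto intro: le_less_trans)
  show ?thesis
  proof
    fix n
    have eq: "s n x = g n x + s (Suc n) x" if "x \<in> {0..1}" for x
      using suminf_split_head[OF su'[OF that, of n]] by (simp add: s_def)
    have "AE x in leb {0..1}. s n x = g n x + s (Suc n) x"
      using eq by (intro AE_I2) (auto simp: space_restrict_space)
    then have "abs_bv (s n) = abs_bv (\<lambda>x. g n x + s (Suc n) x)"
      by (intro bv_abs_eqI s_BV g(1) BV_fun_add)
    then show "abs_bv (s n) = d n + abs_bv (s (Suc n))"
      using s_BV g(1,2) by (simp add: bv_abs_add)
    show "norm (abs_bv (s n)) \<le> 10 * (1/2) ^ n"
      using bv_norm_le[OF s_int s_var _ s_bd, of n] by simp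
  qed
qed

instance bv :: complex_banach
proof
  fix X :: "nat \<Rightarrow> bv" assume X: "Cauchy X"
  have "\<exists>M. \<forall>m\<ge>M. \<forall>n\<ge>M. dist (X m) (X n) < (1/2) ^ k" for k :: nat
    using X[unfolded Cauchy_def] by simp
  then obtain M where M: "\<And>k m n. M k \<le> m \<Longrightarrow> M k \<le> n \<Longrightarrow> dist (X m) (X n) < (1/2) ^ k"
    by metis
  define r where "r k = (\<Sum>i\<le>k. M i)" for k
  have r: "M k \<le> r k" "r k \<le> r (Suc k)" for k
    by (auto simp: r_def intro: member_le_sum)
  define d where "d k = X (r (Suc k)) - X (r k)" for k
  have "norm (d k) \<le> (1/2) ^ k" for k
    using M[of k "r (Suc k)" "r k"] r[of k] by (simp add: d_def dist_norm)
  then obtain t where t: "\<And>n. t n = d n + t (Suc n)" "\<And>n. norm (t n) \<le> 10 * (1/2) ^ n"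
    by (rule bv_geometric_sum[of d]) blast+
  define b where "b = X (r 0) + t 0"
  have b: "b = X (r n) + t n" for n
  proof (induction n)
    case (Suc n)
    then show ?case using t(1)[of n] by (simp add: d_def)
  qed (simp add: b_def)
  have "X \<longlonglongrightarrow> b"
  proof (rule metric_LIMSEQ_I)
    fix e :: real assume "0 < e"
    then obtain k where k: "(1/2) ^ k < e / 11"
      using real_arch_pow_inv[of "e / 11" "1/2"] by auto
    have "dist (X n) b < e" if "n \<ge> r k" for n
    proof -
      have "dist (X n) b \<le> dist (X n) (X (r k)) + dist (X (r k)) b" by (rule dist_triangle)
      also have "dist (X (r k)) b = norm (t k)" using b[of k] by (simp add: dist_norm)
      also have "dist (X n) (X (r k)) + norm (t k) < (1/2) ^ k + 10 * (1/2) ^ k"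
        using M[of k n "r k"] r(1)[of k] that t(2)[of k] by (intro add_less_le_mono) auto
      finally show ?thesis using k by simp
    qed
    then show "\<exists>no. \<forall>n\<ge>no. dist (X n) b < e" by blast
  qed
  then show "convergent X" by (rule convergentI)
qed

lift_definition bv_integral :: "bv \<Rightarrow> complex" is "\<lambda>f. \<integral>x. f x \<partial>leb {0..1}"
  by (intro integral_cong_AE) (auto simp: BV_fun_def)

lift_definition bv_L1_norm :: "bv \<Rightarrow> real" is "\<lambda>f. \<integral>x. cmod (f x) \<partial>leb {0..1}"
  by (intro integral_cong_AE) (auto simp: BV_fun_def)

text \<open>
  The library has no complex measures.  Complex measures on the Borel sets of the real line
  are represented as set functions, which are set to 0 outside the Borel sets.
\<close>

type_synonym complex_measure = "real set \<Rightarrow> complex"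

lift_definition bv_measure :: "bv \<Rightarrow> complex_measure" is
  "\<lambda>f A. if A \<in> sets borel then \<integral>x\<in>A. f x \<partial>leb {0..1} else 0"
proof (rule ext)
  fix f g :: "real \<Rightarrow> complex" and A :: "real set"
  assume fg: "BV_fun {0..1} f \<and> BV_fun {0..1} g \<and> (AE x in leb {0..1}. f x = g x)"
  have "(\<integral>x\<in>A. f x \<partial>leb {0..1}) = (\<integral>x\<in>A. g x \<partial>leb {0..1})" if "A \<in> sets borel"
  proof -
    have "indicator A \<in> borel_measurable (leb {0..1})"
      using that by (intro measurable_restrict_space1 borel_measurable_indicator) simp
    then show ?thesis
      using fg unfolding set_lebesgue_integral_def
      by (intro integral_cong_AE borel_measurable_scaleR) (auto simp: BV_fun_def)
  qed
  then show "(if A \<in> sets borel then \<integral>x\<in>A. f x \<partial>leb {0..1} else 0)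
      = (if A \<in> sets borel then \<integral>x\<in>A. g x \<partial>leb {0..1} else 0)" by simp
qed

definition pushforward :: "real set \<Rightarrow> (real \<Rightarrow> real) \<Rightarrow> complex_measure \<Rightarrow> complex_measure" where
  "pushforward S T \<nu> A = (if A \<in> sets borel then \<nu> (T -` A \<inter> S) else 0)"

text \<open>Same formula as \<open>convolution_emeasure\<close> in HOL-Probability for the convolution of positive measures.\<close>

definition conv_measure :: "real measure \<Rightarrow> complex_measure \<Rightarrow> complex_measure" where
  "conv_measure \<mu> \<nu> A = (if A \<in> sets borel then \<integral>t. \<nu> {y. y + t \<in> A} \<partial>\<mu> else 0)"

definition fold01 :: "real \<Rightarrow> real" where
  "fold01 x = (INF i::int. \<bar>x - 2 * of_int i\<bar>)"

definition noise_measure :: "(real \<Rightarrow> real) \<Rightarrow> real measure" where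
  "noise_measure \<rho> = density (leb {-1..1}) (\<lambda>x. ennreal (\<rho> x))"

definition transfer_measure ::
  "(real \<Rightarrow> real) \<Rightarrow> (real \<Rightarrow> real) \<Rightarrow> complex_measure \<Rightarrow> complex_measure" where
  "transfer_measure T \<rho> \<nu> =
     pushforward UNIV fold01 (conv_measure (noise_measure \<rho>) (pushforward {0..1} T \<nu>))"

text \<open>
  An element of \<^typ>\<open>bv\<close> is determined by the measure of which it is the density.
\<close>

definition transfer_operator :: "(real \<Rightarrow> real) \<Rightarrow> (real \<Rightarrow> real) \<Rightarrow> bv \<Rightarrow> bv" where
  "transfer_operator T \<rho> f = (THE g. bv_measure g = transfer_measure T \<rho> (bv_measure f))"

definition nonsingular :: "(real \<Rightarrow> real) \<Rightarrow> bool" where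
  "nonsingular T \<longleftrightarrow> (\<forall>A\<in>sets (leb {0..1}).
     emeasure (leb {0..1}) (T -` A \<inter> {0..1}) = 0 \<longleftrightarrow> emeasure (leb {0..1}) A = 0)"

end

theory Submission
  imports Defs
begin

text \<open>
  The noise makes the transfer operator an integral operator.  Folding the line onto \<open>[0,1]\<close>
  identifies \<open>y\<close>, \<open>- y\<close> and \<open>2 - y\<close>, and noise of size at most 1 added to a point
  of \<open>[0,1]\<close> stays in \<open>[-1,2]\<close>, where there are no further points over \<open>y\<close>, so
  \<open>L f (y) = \<integral> (\<rho>(y - T x) + \<rho>(- y - T x) + \<rho>(2 - y - T x)) f(x) dx\<close>
  (\<open>integral_fold_noise\<close>, \<open>transfer_operator_abs\<close>).  In \<open>y\<close> the kernel has
  variation bounded uniformly in \<open>x\<close>, since \<open>\<rho>\<close> has bounded variation.  Therefore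
  \<open>\<parallel>L f\<parallel>\<^sub>B\<^sub>V \<le> C \<parallel>f\<parallel>\<^sub>1\<close> (\<open>bv_norm_image_density\<close>), which is stronger than
  a Lasota--Yorke inequality.  Moreover the kernel is nonnegative and integrates to 1, so \<open>L\<close>
  preserves integrals and contracts \<open>L\<^sup>1\<close>.
  
  Convergence to equilibrium says that \<open>L\<^sup>n\<close> tends to 0 pointwise in \<open>L\<^sup>1\<close> on the
  functions of mean zero.  For contractions, pointwise convergence is uniform on compact sets, and
  bounded sets of \<open>BV\<close> are relatively compact in \<open>L\<^sup>1\<close>.  Here compactness enters in the
  quantitative form of approximation by step functions with \<open>N\<close> cells
  (\<open>nn_integral_step_approximation\<close>, \<open>bv_step_approximation\<close>).  So
  \<open>\<parallel>L\<^sup>n f\<parallel>\<^sub>1\<close> is small uniformly over \<open>f\<close> of mean zero in the unit ball of \<open>BV\<close>, and the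
  bound \<open>\<parallel>L f\<parallel>\<^sub>B\<^sub>V \<le> C \<parallel>f\<parallel>\<^sub>1\<close> makes \<open>L\<^sup>n\<^sup>+\<^sup>1\<close> a contraction by 1/2 in \<open>BV\<close> on that subspace
  (\<open>has_spectral_gap_of_L1_regularization\<close>).
  
  The spectral gap is then abstract (\<open>has_spectral_gap_of_contracting_kernel\<close>): the orbit of the
  constant density converges exponentially to an invariant density \<open>h\<close>, the projection
  \<open>P f = (\<integral> f) h\<close> has rank one and commutes with \<open>L\<close>, and \<open>N = L - P\<close> has exponentially
  decaying powers, hence spectral radius below 1 by the Neumann series.
\<close>

section \<open>Spectral gaps from decay on the kernel of an invariant functional\<close>

subclass (in complex_banach) banach ..

lemma bounded_linear_scaleC: "bounded_linear (\<lambda>x::'a::complex_normed_vector. c *\<^sub>C x)"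
proof (rule bounded_linear_intro[where K = "cmod c"])
  fix r and x :: 'a
  show "c *\<^sub>C r *\<^sub>R x = r *\<^sub>R c *\<^sub>C x"
    by (simp flip: scaleC_of_real add: scaleC_scaleC mult.commute)
qed (simp_all add: scaleC_add_right norm_scaleC mult.commute)

lemma bounded_clinear_funpow:
  fixes L :: "'a::complex_normed_vector \<Rightarrow> 'a"
  shows "bounded_clinear L \<Longrightarrow> bounded_clinear (L ^^ n)"
proof (induction n)
  case 0
  show ?case by (simp add: bounded_clinear_def id_def bounded_linear_ident)
next
  case (Suc n)
  then show ?case
    unfolding bounded_clinear_def by (auto simp: o_def intro: bounded_linear_compose)
qed

text \<open>
  Outside the closed disc of radius \<open>r\<close> the Neumann series
  \<open>\<Sum>n. z\<^sup>-\<^sup>n\<^sup>-\<^sup>1 A\<^sup>n\<close> converges, by comparison with the geometric series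
  of ratio \<open>r / \<bar>z\<bar>\<close>, and both products with \<open>z - A\<close> telescope to the identity.
\<close>

lemma spectral_radius_le:
  fixes A :: "'a::complex_banach \<Rightarrow> 'a"
  assumes A: "bounded_clinear A" and r: "0 \<le> r"
    and decay: "\<And>n x. norm ((A ^^ n) x) \<le> C * r ^ n * norm x"
  shows "spectral_radius A \<le> ennreal r"
  unfolding spectral_radius_def
proof (rule SUP_least)
  fix z assume z: "z \<in> spectrum A"
  have "cmod z \<le> r"
  proof (rule ccontr)
    assume "\<not> cmod z \<le> r"
    then have rz: "r < cmod z" and z0: "z \<noteq> 0" using r by auto
    define u where "u n x = inverse z ^ n *\<^sub>C (A ^^ n) x" for n x
    define t where "t n x = inverse z *\<^sub>C u n x" for n x
    have An: "bounded_clinear (A ^^ n)" for n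
      by (rule bounded_clinear_funpow[OF A])
    have u_lin: "bounded_linear (u n)" for n
      unfolding u_def using An
      by (intro bounded_linear_compose[OF bounded_linear_scaleC]) (simp add: bounded_clinear_def)
    have u_C: "u n (c *\<^sub>C x) = c *\<^sub>C u n x" for n c x
      using An by (simp add: u_def bounded_clinear_def scaleC_scaleC mult.commute)
    have t_lin: "bounded_linear (t n)" for n
      unfolding t_def by (rule bounded_linear_compose[OF bounded_linear_scaleC u_lin])
    have u_A: "u (Suc n) x = inverse z *\<^sub>C u n (A x)" for n x
      by (simp add: u_def scaleC_scaleC funpow_Suc_right del: funpow.simps)
    have A_u: "A (u n x) = u n (A x)" for n x
      using A by (simp add: u_def bounded_clinear_def funpow_swap1)
    have u_bd: "norm (u n x) \<le> C * norm x * (r / cmod z) ^ n" for n x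
    proof -
      have "norm (u n x) = (1 / cmod z) ^ n * norm ((A ^^ n) x)"
        by (simp add: u_def norm_scaleC norm_power norm_inverse inverse_eq_divide norm_divide)
      also have "\<dots> \<le> (1 / cmod z) ^ n * (C * r ^ n * norm x)"
        by (intro mult_left_mono decay) simp
      finally show ?thesis by (simp add: power_divide ac_simps)
    qed
    have geo: "summable (\<lambda>n. c * (r / cmod z) ^ n)" for c
      using r rz by (intro summable_mult summable_geometric) (simp add: norm_divide divide_less_eq_1)
    have u_sum: "summable (\<lambda>n. u n x)" for x
      by (rule summable_comparison_test'[OF geo]) (rule u_bd)
    have t_sum: "summable (\<lambda>n. t n x)" for x
      unfolding t_def by (rule bounded_linear.summable[OF bounded_linear_scaleC u_sum])
    have tele: "(\<Sum>n. u n x - u (Suc n) x) = x" for x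
      using telescope_sums'[OF summable_LIMSEQ_zero[OF u_sum[of x]]] complex_vector.scale_one[of x]
      by (simp add: sums_iff u_def)
    define R where "R x = (\<Sum>n. t n x)" for x
    have "bounded_linear R"
    proof (rule bounded_linear_intro)
      fix x y :: 'a and a :: real
      show "R (x + y) = R x + R y"
        unfolding R_def suminf_add[OF t_sum t_sum]
        using t_lin by (simp add: bounded_linear.linear linear_add)
      show "R (a *\<^sub>R x) = a *\<^sub>R R x"
        unfolding R_def using t_lin
        by (simp add: bounded_linear.linear linear_scale suminf_scaleR_right[OF t_sum, symmetric])
      have "norm (t n x) \<le> cmod (inverse z) * C * norm x * (r / cmod z) ^ n" for n
        unfolding t_def norm_scaleC using mult_left_mono[OF u_bd, of "cmod (inverse z)"]
        by (simp add: mult.assoc)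
      then have "norm (R x) \<le> (\<Sum>n. cmod (inverse z) * C * norm x * (r / cmod z) ^ n)"
        unfolding R_def
        by (intro order_trans[OF summable_norm suminf_le] summable_comparison_test'[OF geo] geo) auto
      also have "\<dots> = norm x * (cmod (inverse z) * C * (\<Sum>n. (r / cmod z) ^ n))"
        using geo[of 1] by (subst suminf_mult) auto
      finally show "norm (R x) \<le> norm x * (cmod (inverse z) * C * (\<Sum>n. (r / cmod z) ^ n))" .
    qed
    moreover have "R (c *\<^sub>C x) = c *\<^sub>C R x" for c x
      unfolding R_def bounded_linear.suminf[OF bounded_linear_scaleC t_sum]
      by (simp add: t_def u_C scaleC_scaleC mult.commute)
    ultimately have "bounded_clinear R" by (simp add: bounded_clinear_def)
    moreover have "R (z *\<^sub>C x - A x) = x" for x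
    proof -
      have "t n (z *\<^sub>C x - A x) = u n x - u (Suc n) x" for n
        using t_lin z0 complex_vector.scale_one
        by (simp add: bounded_linear.linear linear_diff)
           (simp add: t_def u_A u_C scaleC_scaleC)
      then show ?thesis using tele by (simp add: R_def)
    qed
    moreover have "z *\<^sub>C R x - A (R x) = x" for x
    proof -
      have "z *\<^sub>C R x - A (R x) = (\<Sum>n. z *\<^sub>C t n x) - (\<Sum>n. A (t n x))"
        unfolding R_def using A
        by (simp add: bounded_clinear_def bounded_linear.suminf[OF _ t_sum]
            bounded_linear.suminf[OF bounded_linear_scaleC t_sum])
      also have "\<dots> = (\<Sum>n. z *\<^sub>C t n x - A (t n x))"
        using A by (intro suminf_diff bounded_linear.summable[OF _ t_sum] bounded_linear_scaleC)
          (simp add: bounded_clinear_def)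
      also have "(\<lambda>n. z *\<^sub>C t n x - A (t n x)) = (\<lambda>n. u n x - u (Suc n) x)"
        using A z0 complex_vector.scale_one
        by (simp add: t_def u_A A_u bounded_clinear_def scaleC_scaleC)
      finally show ?thesis using tele by simp
    qed
    ultimately show False using z unfolding spectrum_def by blast
  qed
  then show "ennreal (cmod z) \<le> ennreal r" by (rule ennreal_leI)
qed

text \<open>
  The decay at the multiples of \<open>m\<close> fixes the rate, and the constant absorbs the growth over
  the at most \<open>m - 1\<close> steps in between.
\<close>

lemma funpow_norm_decay:
  fixes L :: "'a::real_normed_vector \<Rightarrow> 'a"
  assumes L: "bounded_linear L" and V: "\<And>x. x \<in> V \<Longrightarrow> L x \<in> V"
    and m: "0 < m" and half: "\<And>x. x \<in> V \<Longrightarrow> norm ((L ^^ m) x) \<le> 1/2 * norm x"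
  obtains C r where "0 \<le> r" "r < 1" "0 \<le> C" "\<And>n x. x \<in> V \<Longrightarrow> norm ((L ^^ n) x) \<le> C * r ^ n * norm x"
proof -
  define r where "r = root m (1/2)"
  have r: "0 < r" "r < 1" "r ^ m = 1/2"
    using m by (auto simp: r_def real_root_pow_pos2)
  obtain K where K: "\<And>x. norm (L x) \<le> norm x * K" "0 < K"
    using bounded_linear.pos_bounded[OF L] by blast
  \<comment> \<open>A bound of at least 1, so that its powers increase with the exponent.\<close>
  define B where "B = max 1 K"
  have B1: "1 \<le> B" by (simp add: B_def)
  have B: "norm ((L ^^ n) x) \<le> B ^ n * norm x" for n x
  proof (induction n)
    case (Suc n)
    have "norm ((L ^^ Suc n) x) \<le> norm ((L ^^ n) x) * B"
      using K(1)[of "(L ^^ n) x"] mult_left_mono[of K B "norm ((L ^^ n) x)"] by (simp add: B_def)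
    also have "\<dots> \<le> B ^ n * norm x * B"
      using Suc B1 by (intro mult_right_mono) auto
    finally show ?case by (simp add: ac_simps)
  qed simp
  define C where "C = B ^ m / r ^ m"
  have inV: "(L ^^ n) x \<in> V" if "x \<in> V" for n x
    using that V by (induction n) auto
  have "norm ((L ^^ n) x) \<le> C * r ^ n * norm x" if x: "x \<in> V" for n x
  proof (induction n rule: less_induct)
    case (less n)
    show ?case
    proof (cases "n < m")
      case True
      have "B ^ n * r ^ m \<le> B ^ m * r ^ n"
        using True B1 r by (intro mult_mono power_increasing power_decreasing) auto
      then have "B ^ n \<le> C * r ^ n"
        using r(1) by (simp add: C_def field_simps)
      then show ?thesis
        using B[of n x] by (meson mult_right_mono norm_ge_zero order_trans)
    next
      case False
      then have n: "n = m + (n - m)" by simp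
      have "norm ((L ^^ n) x) = norm ((L ^^ m) ((L ^^ (n - m)) x))"
        by (subst n) (simp only: funpow_add o_apply)
      also have "\<dots> \<le> 1/2 * norm ((L ^^ (n - m)) x)" by (rule half[OF inV[OF x]])
      also have "\<dots> \<le> 1/2 * (C * r ^ (n - m) * norm x)"
        using False m by (intro mult_left_mono less) auto
      also have "\<dots> = C * r ^ n * norm x"
        by (subst (2) n) (simp add: power_add r(3))
      finally show ?thesis .
    qed
  qed
  moreover have "0 \<le> C" using B1 r by (simp add: C_def)
  ultimately show thesis using r by (intro that[of r C]) auto
qed

text \<open>
  For a fixed vector \<open>h\<close> of \<open>L\<close> with \<open>\<phi> h = 1\<close>, the invariant
  functional \<open>\<phi>\<close> gives the projection \<open>P x = \<phi> x \<cdot> h\<close>, which commutes with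
  \<open>L\<close> and has the kernel of \<open>\<phi>\<close> as complementary subspace.  On that subspace the
  powers of \<open>L\<close> decay exponentially, so \<open>N = L - P\<close> has spectral radius below 1.
  The same decay yields \<open>h\<close>: the increments \<open>L\<^sup>n (L u - u)\<close> of the orbit of
  \<open>u\<close> lie in the kernel of \<open>\<phi>\<close> and are summable.
\<close>

lemma has_spectral_gap_of_contracting_kernel:
  fixes L :: "'a::complex_banach \<Rightarrow> 'a" and \<phi> :: "'a \<Rightarrow> complex"
  assumes L: "bounded_clinear L"
    and add: "\<And>x y. \<phi> (x + y) = \<phi> x + \<phi> y" and scale: "\<And>c x. \<phi> (c *\<^sub>C x) = c * \<phi> x"
    and bound: "\<And>x. cmod (\<phi> x) \<le> B * norm x"
    and inv: "\<And>x. \<phi> (L x) = \<phi> x" and u: "\<phi> u = 1"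
    and m: "0 < m" and half: "\<And>x. \<phi> x = 0 \<Longrightarrow> norm ((L ^^ m) x) \<le> 1/2 * norm x"
  shows "has_spectral_gap L"
proof -
  have Ll: "bounded_linear L" and LC: "\<And>c x. L (c *\<^sub>C x) = c *\<^sub>C L x"
    using L by (auto simp: bounded_clinear_def)
  have Ladd: "L (x + y) = L x + L y" for x y using Ll by (simp add: bounded_linear.linear linear_add)
  have Ldiff: "L (x - y) = L x - L y" for x y using Ll by (simp add: bounded_linear.linear linear_diff)
  obtain C r where r: "0 \<le> r" "r < 1" "0 \<le> C"
    and decay: "\<And>n x. \<phi> x = 0 \<Longrightarrow> norm ((L ^^ n) x) \<le> C * r ^ n * norm x"
    by (rule funpow_norm_decay[OF Ll, of "{x. \<phi> x = 0}" m]) (use m half inv in auto)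
  have diff: "\<phi> (x - y) = \<phi> x - \<phi> y" for x y
    using add[of "x - y" y] by simp
  have \<phi>_lin: "bounded_linear \<phi>"
  proof (rule bounded_linear_intro)
    show "\<phi> (a *\<^sub>R x) = a *\<^sub>R \<phi> x" for a x
      using scale[of "of_real a" x] by (simp add: scaleC_of_real scaleR_conv_of_real)
    show "norm (\<phi> x) \<le> norm x * B" for x using bound[of x] by (simp add: mult.commute)
  qed (rule add)
  define d where "d = L u - u"
  have d0: "\<phi> d = 0" by (simp add: d_def diff inv)
  have Ln_inv: "\<phi> ((L ^^ n) x) = \<phi> x" for n x by (induction n) (auto simp: inv)
  have sumd: "summable (\<lambda>n. (L ^^ n) d)"
  proof (rule summable_comparison_test')
    show "summable (\<lambda>n. C * norm d * r ^ n)" using r by (intro summable_mult summable_geometric) simp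
    show "norm ((L ^^ n) d) \<le> C * norm d * r ^ n" for n using decay[OF d0, of n] by (simp add: ac_simps)
  qed
  \<comment> \<open>The limit of \<open>L\<^sup>n u\<close>, written as a telescoped series.\<close>
  define h where "h = u + (\<Sum>n. (L ^^ n) d)"
  have \<phi>h: "\<phi> h = 1"
    by (simp add: h_def add u bounded_linear.suminf[OF \<phi>_lin sumd] Ln_inv d0)
  have Lh: "L h = h"
    using bounded_linear.suminf[OF Ll sumd] suminf_split_head[OF sumd]
    by (simp add: h_def Ladd d_def)
  define P where "P x = \<phi> x *\<^sub>C h" for x
  define N where "N x = L x - P x" for x
  have P: "bounded_clinear P"
  proof -
    have "bounded_linear P"
    proof (rule bounded_linear_intro)
      show "P (x + y) = P x + P y" for x y by (simp add: P_def add scaleC_add_left)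
      show "P (a *\<^sub>R x) = a *\<^sub>R P x" for a x
        by (simp add: P_def scale scaleC_scaleC flip: scaleC_of_real)
      show "norm (P x) \<le> norm x * (B * norm h)" for x
        using mult_right_mono[OF bound[of x], of "norm h"] by (simp add: P_def norm_scaleC ac_simps)
    qed
    then show ?thesis by (simp add: bounded_clinear_def P_def scale scaleC_scaleC)
  qed
  have N: "bounded_clinear N"
    using P L unfolding bounded_clinear_def N_def
    by (auto intro: bounded_linear_sub simp: complex_vector.scale_right_diff_distrib)
  \<comment> \<open>For \<open>n = 0\<close> the right-hand side would be \<open>x - P x\<close> instead of \<open>x\<close>.\<close>
  have N_pow: "(N ^^ n) x = (L ^^ n) (x - P x)" if "0 < n" for n x
    using that
  proof (induction n rule: nat_induct_non_zero)
    case 1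
    then show ?case by (simp add: N_def Ldiff P_def LC Lh)
  next
    case (Suc n)
    have "\<phi> ((L ^^ n) (x - P x)) = 0" by (simp add: Ln_inv diff P_def scale \<phi>h)
    then show ?case using Suc by (simp add: N_def P_def)
  qed
  obtain K where K: "\<And>x. norm (P x) \<le> norm x * K" "0 < K"
    using P bounded_linear.pos_bounded[of P] by (auto simp: bounded_clinear_def)
  have "norm ((N ^^ n) x) \<le> max 1 (C * (1 + K)) * r ^ n * norm x" for n x
  proof (cases "n = 0")
    case True
    have "1 * norm x \<le> max 1 (C * (1 + K)) * norm x" by (intro mult_right_mono) auto
    then show ?thesis using True by simp
  next
    case False
    have "norm ((N ^^ n) x) = norm ((L ^^ n) (x - P x))" using False by (simp add: N_pow)
    also have "\<dots> \<le> C * r ^ n * norm (x - P x)"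
      by (rule decay) (simp add: diff P_def scale \<phi>h)
    also have "\<dots> \<le> C * r ^ n * ((1 + K) * norm x)"
      using norm_triangle_ineq4[of x "P x"] K(1)[of x] r
      by (intro mult_left_mono) (auto simp: algebra_simps)
    also have "\<dots> = C * (1 + K) * (r ^ n * norm x)" by simp
    also have "\<dots> \<le> max 1 (C * (1 + K)) * (r ^ n * norm x)"
      using r by (intro mult_right_mono) auto
    finally show ?thesis by simp
  qed
  then have "spectral_radius N \<le> ennreal r"
    by (intro spectral_radius_le N r) auto
  then have sr: "spectral_radius N < ennreal (cmod 1)"
    by (rule le_less_trans) (use r in \<open>simp add: ennreal_less_one_iff\<close>)
  have h0: "h \<noteq> 0" using \<phi>h diff[of 0 0] by auto
  have "range P = complex_vector.span {h}"
  proof -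
    have "c *\<^sub>C h \<in> range P" for c
      using rangeI[of P "c *\<^sub>C h"] by (simp add: P_def scale \<phi>h)
    then have "range P = (\<lambda>c. c *\<^sub>C h) ` UNIV"
      by (intro equalityI image_subsetI) (auto simp: P_def)
    then show ?thesis by (simp add: complex_vector.span_singleton)
  qed
  then have dimP: "complex_vector.dim (range P) = 1"
    using h0 complex_vector.span_base[of h "{h}"]
    by (intro complex_vector.dim_unique[of "{h}"]) auto
  have "P \<circ> P = P" by (auto simp: P_def scale \<phi>h)
  moreover have "P \<circ> N = (\<lambda>x. 0)" by (auto simp: P_def N_def diff scale \<phi>h inv)
  moreover have "N \<circ> P = (\<lambda>x. 0)" by (auto simp: P_def N_def LC Lh scale \<phi>h)
  moreover have "L x = 1 *\<^sub>C P x + N x" for x by (simp add: N_def)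
  ultimately show ?thesis
    unfolding has_spectral_gap_def using P N sr dimP by blast
qed

section \<open>Variation and step approximation\<close>

lemma variation_subset: "S \<subseteq> S' \<Longrightarrow> variation S f \<le> variation S' f"
  unfolding variation_le_iff by (intro allI impI variation_sumD) auto

lemma variation_shift: "variation S (\<lambda>x. f (c + x)) \<le> variation UNIV f"
  unfolding variation_le_iff
proof (intro allI impI)
  fix n and x :: "nat \<Rightarrow> real"
  assume "\<forall>i<n. x i < x (Suc i)"
  then show "(\<Sum>i<n. ennreal (norm (f (c + x i) - f (c + x (Suc i))))) \<le> variation UNIV f"
    by (intro variation_sumD[where x = "\<lambda>i. c + x i"]) auto
qed

lemma variation_reflect: "variation S (\<lambda>x. f (c - x)) \<le> variation ((-) c ` S) f"
  unfolding variation_le_iff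
proof (intro allI impI)
  fix n and x :: "nat \<Rightarrow> real"
  assume x: "\<forall>i\<le>n. x i \<in> S" "\<forall>i<n. x i < x (Suc i)"
  define g where "g i = ennreal (norm (f (c - x i) - f (c - x (Suc i))))" for i
  have "(\<Sum>i<n. g i) = (\<Sum>i<n. g (n - Suc i))"
    by (rule sum.nat_diff_reindex[symmetric])
  also have "\<dots> = (\<Sum>i<n. ennreal (norm (f (c - x (n - i)) - f (c - x (n - Suc i)))))"
    by (intro sum.cong refl) (auto simp: g_def Suc_diff_Suc norm_minus_commute)
  also have "\<dots> \<le> variation ((-) c ` S) f"
  proof (rule variation_sumD[where x = "\<lambda>i. c - x (n - i)"])
    show "\<forall>i<n. c - x (n - i) < c - x (n - Suc i)"
    proof (intro allI impI)
      fix i assume "i < n"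
      then show "c - x (n - i) < c - x (n - Suc i)"
        using x(2)[rule_format, of "n - Suc i"] by (simp add: Suc_diff_Suc)
    qed
  qed (use x in auto)
  finally show "(\<Sum>i<n. ennreal (norm (f (c - x i) - f (c - x (Suc i))))) \<le> variation ((-) c ` S) f"
    by (simp add: g_def)
qed

lemma variation_norm: "variation S (\<lambda>x. norm (f x)) \<le> variation S f"
  unfolding variation_le_iff
proof (intro allI impI)
  fix n and x :: "nat \<Rightarrow> real"
  assume x: "\<forall>i\<le>n. x i \<in> S" "\<forall>i<n. x i < x (Suc i)"
  have "(\<Sum>i<n. ennreal (norm (norm (f (x i)) - norm (f (x (Suc i))))))
      \<le> (\<Sum>i<n. ennreal (norm (f (x i) - f (x (Suc i)))))"
    by (intro sum_mono ennreal_leI) (simp add: norm_triangle_ineq3)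
  also have "\<dots> \<le> variation S f" by (rule variation_sumD[OF x])
  finally show "(\<Sum>i<n. ennreal (norm (norm (f (x i)) - norm (f (x (Suc i)))))) \<le> variation S f" .
qed

lemma variation_cong: "(\<And>x. x \<in> S \<Longrightarrow> f x = g x) \<Longrightarrow> variation S f = variation S g"
  unfolding variation_def by (intro SUP_cong refl) (auto intro!: sum.cong)

lemma norm_diff_le_variation:
  assumes "x \<in> S" "y \<in> S"
  shows "ennreal (norm (f x - f y)) \<le> variation S f"
proof -
  have *: "ennreal (norm (f a - f b)) \<le> variation S f" if "a \<in> S" "b \<in> S" "a < b" for a b
    using variation_sumD[of 1 "\<lambda>i. if i = 0 then a else b" S f] that by (auto simp: le_Suc_eq)
  show ?thesis
    using *[of x y] *[of y x] assms
    by (cases x y rule: linorder_cases) (auto simp: norm_minus_commute)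
qed

text \<open>
  Once a downward closed condition \<open>Q\<close> fails along an increasing sequence, it keeps failing.
  So the truncated function has the increments of \<open>f\<close>, then at most one jump to 0, and is
  constant afterwards.
\<close>

lemma variation_cut:
  assumes Q: "\<And>x y. x \<le> y \<Longrightarrow> Q y \<Longrightarrow> Q x"
    and M: "\<And>x. x \<in> S \<Longrightarrow> Q x \<Longrightarrow> norm (f x) \<le> M"
  shows "variation S (\<lambda>x. if Q x then f x else 0) \<le> variation {x \<in> S. Q x} f + ennreal M"
  unfolding variation_le_iff
proof (intro allI impI)
  fix n and x :: "nat \<Rightarrow> real"
  let ?g = "\<lambda>x. if Q x then f x else 0" and ?V = "variation {x \<in> S. Q x} f"
  assume "\<forall>i\<le>n. x i \<in> S" "\<forall>i<n. x i < x (Suc i)"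
  \<comment> \<open>The induction has to record whether the jump has already been paid for.\<close>
  then have "(\<Sum>i<n. ennreal (norm (?g (x i) - ?g (x (Suc i))))) \<le> (if Q (x n) then ?V else ?V + ennreal M)"
  proof (induction n)
    case (Suc n)
    then have IH: "(\<Sum>i<n. ennreal (norm (?g (x i) - ?g (x (Suc i))))) \<le> (if Q (x n) then ?V else ?V + ennreal M)"
      by auto
    show ?case
    proof (cases "Q (x (Suc n))")
      case True
      have "Q (x i)" if "i \<le> Suc n" for i
      proof -
        have "x i \<le> x (Suc n)"
          using that Suc.prems(2) by (induction rule: inc_induct) force+
        then show ?thesis using Q True by blast
      qed
      note Qx = this
      then have "(\<Sum>i<Suc n. ennreal (norm (?g (x i) - ?g (x (Suc i)))))
          = (\<Sum>i<Suc n. ennreal (norm (f (x i) - f (x (Suc i)))))"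
        by (intro sum.cong refl) auto
      also have "\<dots> \<le> ?V"
        using Suc.prems Qx by (intro variation_sumD) auto
      finally show ?thesis using True by simp
    next
      case False
      then show ?thesis
        using IH M[of "x n"] Suc.prems(1)
        by (auto intro!: add_mono ennreal_leI split: if_splits)
    qed
  qed simp
  then show "(\<Sum>i<n. ennreal (norm (?g (x i) - ?g (x (Suc i))))) \<le> ?V + ennreal M"
    by (rule order_trans) simp
qed

text \<open>
  Each end point of the interval costs at most one jump.  The cut on the left is reduced to a cut
  on the right by reflection.
\<close>

lemma variation_extend_by_zero:
  assumes M: "\<And>x. x \<in> {a..b} \<Longrightarrow> norm (f x) \<le> M"
  shows "variation UNIV (\<lambda>x. if x \<in> {a..b} then f x else 0) \<le> variation {a..b} f + ennreal M + ennreal M"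
proof (cases "a \<le> b")
  case True
  then have M0: "0 \<le> M" using M[of a] norm_ge_zero[of "f a"] by (simp del: norm_ge_zero)
  let ?h = "\<lambda>x. if a \<le> x then f x else 0" and ?k = "\<lambda>y. if y \<le> - a then f (- y) else 0"
  have "variation UNIV (\<lambda>x. if x \<in> {a..b} then f x else 0) = variation UNIV (\<lambda>x. if x \<le> b then ?h x else 0)"
    by (intro variation_cong) auto
  also have "\<dots> \<le> variation {x \<in> UNIV. x \<le> b} ?h + ennreal M"
    by (rule variation_cut) (use M M0 in auto)
  also have "{x \<in> UNIV. x \<le> b} = {..b}" by auto
  also have "variation {..b} ?h = variation {..b} (\<lambda>x. ?k (0 - x))"
    by (intro variation_cong) auto
  also have "\<dots> \<le> variation ((-) 0 ` {..b}) ?k" by (rule variation_reflect)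
  also have "(-) 0 ` {..b} = {-b..}" by simp
  also have "variation {-b..} ?k \<le> variation {x \<in> {-b..}. x \<le> - a} (\<lambda>y. f (0 - y)) + ennreal M"
    using variation_cut[where Q = "\<lambda>y. y \<le> - a" and S = "{-b..}" and f = "\<lambda>y. f (- y)" and M = M]
      M by fastforce
  also have "variation {x \<in> {-b..}. x \<le> - a} (\<lambda>y. f (0 - y)) \<le> variation ((-) 0 ` {x \<in> {-b..}. x \<le> - a}) f"
    by (rule variation_reflect)
  also have "\<dots> \<le> variation {a..b} f" by (rule variation_subset) auto
  finally show ?thesis by (simp add: add_right_mono)
next
  case False
  then show ?thesis by (simp add: variation_zero)
qed

text \<open>
  The indicator is the difference of two half-line indicators, each with a single unit jump.
\<close>

lemma variation_indicator_atLeastLessThan: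
  assumes "a \<le> b"
  shows "variation S (indicator {a..<b} :: real \<Rightarrow> complex) \<le> 2"
proof -
  have 1: "variation S (\<lambda>x. if x < c then 1 else 0 :: complex) \<le> 1" for c
  proof -
    have "variation {x \<in> S. x < c} (\<lambda>x. 1 :: complex) = 0"
      using variation_le_iff[of "{x \<in> S. x < c}" "\<lambda>x. 1 :: complex" 0] by simp
    then show ?thesis
      using variation_cut[of "\<lambda>x. x < c" S "\<lambda>x. 1 :: complex" 1] by simp
  qed
  have "variation S (indicator {a..<b} :: real \<Rightarrow> complex)
      = variation S (\<lambda>x. (if x < b then 1 else 0) + (- 1) * (if x < a then 1 else 0 :: complex))"
    using assms by (intro variation_cong) (auto simp: indicator_def)
  also have "\<dots> \<le> variation S (\<lambda>x. if x < b then 1 else 0 :: complex)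
      + variation S (\<lambda>x. (- 1) * (if x < a then 1 else 0 :: complex))"
    by (rule variation_add)
  also have "\<dots> \<le> 1 + ennreal (cmod (- 1)) * variation S (\<lambda>x. if x < a then 1 else 0 :: complex)"
    by (intro add_mono 1 variation_mult)
  also have "\<dots> \<le> 1 + 1" using 1[of a] by (intro add_mono order_refl) simp
  finally show ?thesis by simp
qed

text \<open>
  The points \<open>0 < t < 1/N < 1/N + t < \<dots>\<close> form an increasing sequence in the unit
  interval, and the sum on the left consists of every second increment along it.
\<close>

lemma sum_shifted_increments_le_variation:
  fixes f :: "real \<Rightarrow> 'a::real_normed_vector" and N :: nat
  assumes t: "0 < t" "t < 1 / N" and N: "0 < N"
  shows "(\<Sum>i<N. ennreal (norm (f (real i / N + t) - f (real i / N)))) \<le> variation {0..1} f"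
proof -
  define x where "x j = real (j div 2) / N + (if odd j then t else 0)" for j
  have double: "(\<Sum>j<2 * n. g j) = (\<Sum>i<n. g (2 * i) + g (Suc (2 * i)))" for n and g :: "nat \<Rightarrow> ennreal"
    by (induction n) (auto simp: ac_simps)
  have x2: "x (2 * i) = real i / N" "x (Suc (2 * i)) = real i / N + t" for i
    by (auto simp: x_def)
  have "(\<Sum>i<N. ennreal (norm (f (real i / N + t) - f (real i / N))))
      \<le> (\<Sum>i<N. ennreal (norm (f (x (2 * i)) - f (x (Suc (2 * i)))))
          + ennreal (norm (f (x (Suc (2 * i))) - f (x (Suc (Suc (2 * i)))))))"
    by (intro sum_mono) (simp add: x2 norm_minus_commute)
  also have "\<dots> = (\<Sum>j<2 * N. ennreal (norm (f (x j) - f (x (Suc j)))))"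
    by (simp add: double)
  also have "\<dots> \<le> variation {0..1} f"
  proof (rule variation_sumD)
    have step: "x j < x (Suc j)" for j
    proof (cases "even j")
      case True
      then show ?thesis using t by (auto simp: x_def)
    next
      case False
      then obtain i where j: "j = Suc (2 * i)" by (metis oddE Suc_eq_plus1)
      have "x (Suc j) = real (Suc i) / N" using x2(1)[of "Suc i"] j by simp
      also have "real (Suc i) / N = real i / N + 1 / N" by (simp add: add_divide_distrib)
      finally show ?thesis using t by (simp add: j x2)
    qed
    then show "\<forall>i<2 * N. x i < x (Suc i)" by blast
    have "x j \<le> 1" if "j \<le> 2 * N" for j
    proof -
      have "mono x" by (intro mono_iff_le_Suc[THEN iffD2] allI less_imp_le step)
      then have "x j \<le> x (2 * N)" using that by (rule monoD)
      then show ?thesis using N by (simp add: x2)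
    qed
    moreover have "0 \<le> x j" for j using t by (auto simp: x_def)
    ultimately show "\<forall>i\<le>2 * N. x i \<in> {0..1}" by auto
  qed
  finally show ?thesis .
qed

text \<open>
  The half-open cells of length \<open>1/N\<close> partition \<open>[0,1)\<close>; the equivalence in the
  conclusion evaluates all their indicators at \<open>x\<close> at once.
\<close>

lemma obtain_cell:
  fixes x :: real and N :: nat
  assumes "0 \<le> x" "x < 1" "0 < N"
  obtains i where "i < N" "\<And>j. x \<in> {real j / N..<real (Suc j) / N} \<longleftrightarrow> j = i"
proof
  let ?i = "nat \<lfloor>x * N\<rfloor>"
  have pos: "0 \<le> x * N" using assms by simp
  have "x * N < N" using assms by simp
  then have "\<lfloor>x * N\<rfloor> < int N" by (simp add: floor_less_iff)
  then show "?i < N" using assms by (simp add: nat_less_iff)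
  fix j
  have "x \<in> {real j / N..<real (Suc j) / N} \<longleftrightarrow> real j \<le> x * N \<and> x * N < real j + 1"
    using assms by (auto simp: field_simps)
  also have "\<dots> \<longleftrightarrow> \<lfloor>x * N\<rfloor> = int j" by (auto simp: floor_eq_iff)
  also have "\<dots> \<longleftrightarrow> j = ?i" using pos by auto
  finally show "x \<in> {real j / N..<real (Suc j) / N} \<longleftrightarrow> j = ?i" .
qed

text \<open>
  Sampling \<open>f\<close> at the left end points of \<open>N\<close> equal cells approximates it in
  \<open>L\<^sup>1\<close> at the rate \<open>Var f / N\<close>.  After all cells are translated to
  \<open>[0,1/N)\<close>, the integrand at \<open>t\<close> is a sum of increments of length \<open>t\<close>,
  which the variation bounds independently of \<open>t\<close>.
\<close>

lemma nn_integral_step_approximation: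
  fixes f :: "real \<Rightarrow> complex" and N :: nat
  assumes f: "f \<in> borel_measurable (leb {0..1})" and N: "0 < N"
  shows "(\<integral>\<^sup>+x. norm (f x - (\<Sum>i<N. f (real i / N) * indicator {real i / N..<real (Suc i) / N} x)) \<partial>leb {0..1})
    \<le> variation {0..1} f * ennreal (1 / N)"
proof -
  let ?I = "\<lambda>i. {real i / N..<real (Suc i) / N}"
  define F where "F x = indicator {0..1} x *\<^sub>R f x" for x
  have [measurable]: "F \<in> borel_measurable borel"
    using f unfolding F_def by (simp add: borel_measurable_restrict_space_iff)
  have "(\<integral>\<^sup>+x. norm (f x - (\<Sum>i<N. f (real i / N) * indicator (?I i) x)) \<partial>leb {0..1})
      = (\<integral>\<^sup>+x. ennreal (norm (f x - (\<Sum>i<N. f (real i / N) * indicator (?I i) x))) * indicator {0..1} x \<partial>lborel)"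
    by (rule nn_integral_restrict_space) simp
  also have "\<dots> \<le> (\<integral>\<^sup>+x. (\<Sum>i<N. indicator (?I i) x * ennreal (norm (F x - f (real i / N)))) \<partial>lborel)"
  proof (rule nn_integral_mono_AE)
    show "AE x in lborel. ennreal (norm (f x - (\<Sum>i<N. f (real i / N) * indicator (?I i) x))) * indicator {0..1} x
        \<le> (\<Sum>i<N. indicator (?I i) x * ennreal (norm (F x - f (real i / N))))"
      using AE_lborel_singleton[of 1]
    proof eventually_elim
      fix x :: real assume x1: "x \<noteq> 1"
      show "ennreal (norm (f x - (\<Sum>i<N. f (real i / N) * indicator (?I i) x))) * indicator {0..1} x
        \<le> (\<Sum>i<N. indicator (?I i) x * ennreal (norm (F x - f (real i / N))))"
      proof (cases "x \<in> {0..1}")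
        case True
        then obtain i where i: "i < N" "\<And>j. x \<in> ?I j \<longleftrightarrow> j = i"
          using obtain_cell[of x N] x1 N by auto
        then have ind: "indicator (?I j) x = (if j = i then 1 else 0 :: 'b::zero_neq_one)" for j
          by (simp add: indicator_def)
        show ?thesis
          unfolding ind using i True by (simp add: F_def if_distrib if_distribR sum.delta cong: if_cong)
      qed simp
    qed
  qed
  also have "\<dots> = (\<Sum>i<N. \<integral>\<^sup>+x. indicator (?I i) x * ennreal (norm (F x - f (real i / N))) \<partial>lborel)"
    by (rule nn_integral_sum) simp
  also have "\<dots> = (\<Sum>i<N. \<integral>\<^sup>+t. indicator {0..<1 / N} t * ennreal (norm (F (real i / N + t) - f (real i / N))) \<partial>lborel)"
  proof (intro sum.cong refl)
    fix i
    have "(\<integral>\<^sup>+x. indicator (?I i) x * ennreal (norm (F x - f (real i / N))) \<partial>lborel)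
      = (\<integral>\<^sup>+t. indicator (?I i) (real i / N + 1 * t) * ennreal (norm (F (real i / N + 1 * t) - f (real i / N))) \<partial>lborel)"
      by (subst nn_integral_real_affine[where c = 1 and t = "real i / N"]) auto
    then show "(\<integral>\<^sup>+x. indicator (?I i) x * ennreal (norm (F x - f (real i / N))) \<partial>lborel)
      = (\<integral>\<^sup>+t. indicator {0..<1 / N} t * ennreal (norm (F (real i / N + t) - f (real i / N))) \<partial>lborel)"
      by (simp add: indicator_def add_divide_distrib)
  qed
  also have "\<dots> = (\<integral>\<^sup>+t. (\<Sum>i<N. indicator {0..<1 / N} t * ennreal (norm (F (real i / N + t) - f (real i / N)))) \<partial>lborel)"
    by (rule nn_integral_sum[symmetric]) simp
  also have "\<dots> \<le> (\<integral>\<^sup>+t. variation {0..1} f * indicator {0..<1 / N} t \<partial>lborel)"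
  proof (rule nn_integral_mono_AE)
    show "AE t in lborel. (\<Sum>i<N. indicator {0..<1 / N} t * ennreal (norm (F (real i / N + t) - f (real i / N))))
      \<le> variation {0..1} f * indicator {0..<1 / N} t"
      using AE_lborel_singleton[of 0]
    proof eventually_elim
      fix t :: real assume t0: "t \<noteq> 0"
      show "(\<Sum>i<N. indicator {0..<1 / N} t * ennreal (norm (F (real i / N + t) - f (real i / N))))
        \<le> variation {0..1} f * indicator {0..<1 / N} t"
      proof (cases "t \<in> {0..<1 / N}")
        case True
        then have t: "0 < t" "t < 1 / N" using t0 by auto
        have "F (real i / N + t) = f (real i / N + t)" if "i < N" for i
        proof -
          have "real i / N + t \<le> real i / N + 1 / N" using t by simp
          also have "\<dots> = real (Suc i) / N" by (simp add: add_divide_distrib)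
          also have "\<dots> \<le> 1" using that by (simp add: field_simps)
          finally show ?thesis using t by (simp add: F_def)
        qed
        then show ?thesis
          using sum_shifted_increments_le_variation[OF t N, of f] True by simp
      qed simp
    qed
  qed
  also have "\<dots> = variation {0..1} f * ennreal (1 / N)"
    by (subst nn_integral_cmult_indicator) auto
  finally show ?thesis .
qed

section \<open>Integral, \<open>L\<^sup>1\<close> norm and step functions in BV\<close>

lemma bv_cases:
  fixes b :: bv
  obtains f where "BV_fun {0..1} f" "b = abs_bv f"
  using bv_representative[of 1 b] by (metis zero_less_one)

lemma BV_fun_integrable: "BV_fun S f \<Longrightarrow> integrable (leb S) f"
  by (simp add: BV_fun_def)

lemma bv_integral_abs: "BV_fun {0..1} f \<Longrightarrow> bv_integral (abs_bv f) = (\<integral>x. f x \<partial>leb {0..1})"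
  by (simp add: bv_integral.abs_eq)

lemma bv_L1_norm_abs: "BV_fun {0..1} f \<Longrightarrow> bv_L1_norm (abs_bv f) = (\<integral>x. cmod (f x) \<partial>leb {0..1})"
  by (simp add: bv_L1_norm.abs_eq)

lemma bv_scaleC_abs: "BV_fun {0..1} f \<Longrightarrow> c *\<^sub>C abs_bv f = abs_bv (\<lambda>x. c * f x)"
  by (simp add: scaleC_bv.abs_eq)

lemma bv_integral_add: "bv_integral (a + b) = bv_integral a + bv_integral b"
proof -
  obtain f g where f: "BV_fun {0..1} f" "a = abs_bv f" and g: "BV_fun {0..1} g" "b = abs_bv g"
    by (metis bv_cases)
  show ?thesis
    using f g BV_fun_add[OF f(1) g(1)]
    by (simp add: bv_integral_abs BV_fun_integrable flip: bv_abs_add)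
qed

lemma bv_integral_scaleC: "bv_integral (c *\<^sub>C b) = c * bv_integral b"
  by (cases b rule: bv_cases) (simp add: bv_integral_abs bv_scaleC_abs BV_fun_mult)

lemma cmod_bv_integral_le: "cmod (bv_integral b) \<le> bv_L1_norm b"
  by (cases b rule: bv_cases) (simp add: bv_integral_abs bv_L1_norm_abs integral_norm_bound)

lemma bv_L1_norm_le_norm: "bv_L1_norm b \<le> norm b"
  by (cases b rule: bv_cases) (simp add: bv_L1_norm_abs norm_bv.abs_eq BV_norm_def enn2real_nonneg)

lemma bv_L1_norm_add: "bv_L1_norm (a + b) \<le> bv_L1_norm a + bv_L1_norm b"
proof -
  obtain f g where f: "BV_fun {0..1} f" "a = abs_bv f" and g: "BV_fun {0..1} g" "b = abs_bv g"
    by (metis bv_cases)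
  have "bv_L1_norm (a + b) = (\<integral>x. cmod (f x + g x) \<partial>leb {0..1})"
    using f g BV_fun_add[OF f(1) g(1)] by (simp add: bv_L1_norm_abs flip: bv_abs_add)
  also have "\<dots> \<le> (\<integral>x. cmod (f x) + cmod (g x) \<partial>leb {0..1})"
    using BV_fun_integrable[OF f(1)] BV_fun_integrable[OF g(1)]
    by (intro integral_mono integrable_norm Bochner_Integration.integrable_add norm_triangle_ineq)
  also have "\<dots> = bv_L1_norm a + bv_L1_norm b"
    using f g by (simp add: bv_L1_norm_abs BV_fun_integrable)
  finally show ?thesis .
qed

lemma bv_L1_norm_scaleC: "bv_L1_norm (c *\<^sub>C b) = cmod c * bv_L1_norm b"
  by (cases b rule: bv_cases) (simp add: bv_L1_norm_abs bv_scaleC_abs BV_fun_mult norm_mult)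

lemma bv_L1_norm_nonneg: "0 \<le> bv_L1_norm b"
  by (rule order_trans[OF norm_ge_zero cmod_bv_integral_le])

lemma bv_L1_norm_zero: "bv_L1_norm 0 = 0"
  using bv_L1_norm_le_norm[of 0] bv_L1_norm_nonneg[of 0] by simp

lemma bv_L1_norm_sum: "bv_L1_norm (\<Sum>i\<in>I. f i) \<le> (\<Sum>i\<in>I. bv_L1_norm (f i))"
  by (induction I rule: infinite_finite_induct)
    (auto simp: bv_L1_norm_zero intro: order_trans[OF bv_L1_norm_add])

lemma BV_fun_const: "BV_fun {0..1} (\<lambda>x. c)"
proof (rule BV_fun_of_variation)
  interpret finite_measure "leb {0..1}" by (rule measure_leb01)
  show "integrable (leb {0..1}) (\<lambda>x. c)" by simp
  have "variation {0..1} (\<lambda>x. c) \<le> 0"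
    using variation_le_iff[of "{0..1}" "\<lambda>x. c" 0] by simp
  then show "variation {0..1} (\<lambda>x. c) < top" by (simp add: le_zero_eq)
qed

lemma BV_fun_sum:
  "(\<And>i. i \<in> I \<Longrightarrow> BV_fun {0..1} (f i)) \<Longrightarrow> BV_fun {0..1} (\<lambda>x. \<Sum>i\<in>I. f i x)"
  by (induction I rule: infinite_finite_induct) (auto simp: BV_fun_zero BV_fun_add)

lemma bv_abs_sum:
  "finite I \<Longrightarrow> (\<And>i. i \<in> I \<Longrightarrow> BV_fun {0..1} (f i)) \<Longrightarrow> abs_bv (\<lambda>x. \<Sum>i\<in>I. f i x) = (\<Sum>i\<in>I. abs_bv (f i))"
  by (induction I rule: finite_induct) (auto simp: zero_bv_def bv_abs_add BV_fun_sum)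

lemma BV_fun_indicator:
  assumes "a \<le> b"
  shows "BV_fun {0..1} (indicator {a..<b} :: real \<Rightarrow> complex)"
proof (rule BV_fun_of_variation)
  interpret finite_measure "leb {0..1}" by (rule measure_leb01)
  show "integrable (leb {0..1}) (indicator {a..<b} :: real \<Rightarrow> complex)"
    by (rule integrable_const_bound[where B = 1])
      (auto simp: indicator_def intro!: measurable_restrict_space1)
  show "variation {0..1} (indicator {a..<b} :: real \<Rightarrow> complex) < top"
    using variation_indicator_atLeastLessThan[OF assms] by (rule le_less_trans) simp
qed

text \<open>
  This replaces the compact embedding of \<open>BV\<close> into \<open>L\<^sup>1\<close>: up to an error of
  order \<open>1/N\<close> in \<open>L\<^sup>1\<close>, the unit ball of \<open>BV\<close> lies in the span of
  \<open>N\<close> fixed elements, with bounded coefficients.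
\<close>

lemma bv_step_approximation:
  fixes b :: bv and N :: nat
  assumes N: "0 < N"
  obtains c q where "b = (\<Sum>i<N. c i *\<^sub>C abs_bv (indicator {real i / N..<real (Suc i) / N})) + q"
    "\<And>i. i < N \<Longrightarrow> cmod (c i) \<le> 3 * norm b" "bv_L1_norm q \<le> 2 * norm b / N"
proof (cases "b = 0")
  case True
  then show ?thesis by (intro that[of "\<lambda>_. 0" 0]) (auto simp: bv_L1_norm_zero)
next
  case False
  let ?I = "\<lambda>i. indicator {real i / N..<real (Suc i) / N} :: real \<Rightarrow> complex"
  \<comment> \<open>The infimum over representatives need not be attained; losing a factor 2 is harmless.\<close>
  obtain f where f: "BV_fun {0..1} f" "abs_bv f = b"
    and var: "variation {0..1} f \<le> ennreal (norm b + norm b)"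
    and L1: "(\<integral>x. norm (f x) \<partial>leb {0..1}) \<le> norm b"
    using bv_representative[of "norm b" b] False by auto
  define s where "s x = (\<Sum>i<N. f (real i / N) * ?I i x)" for x
  have BV_I: "BV_fun {0..1} (?I i)" for i
    by (rule BV_fun_indicator) (simp add: divide_right_mono)
  have BV_s: "BV_fun {0..1} s"
    unfolding s_def by (intro BV_fun_sum BV_fun_mult BV_I)
  have BV_q: "BV_fun {0..1} (\<lambda>x. f x - s x)"
    using BV_fun_add[OF f(1) BV_fun_mult[OF BV_s, of "-1"]] by simp
  have "abs_bv s = (\<Sum>i<N. abs_bv (\<lambda>x. f (real i / N) * ?I i x))"
    unfolding s_def[abs_def] by (rule bv_abs_sum[OF finite_lessThan BV_fun_mult[OF BV_I]])
  then have abs_s: "abs_bv s = (\<Sum>i<N. f (real i / N) *\<^sub>C abs_bv (?I i))"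
    unfolding bv_scaleC_abs[OF BV_I] .
  show ?thesis
  proof (rule that)
    have "b = abs_bv (\<lambda>x. s x + (f x - s x))" using f(2) by simp
    also have "\<dots> = abs_bv s + abs_bv (\<lambda>x. f x - s x)" by (rule bv_abs_add[OF BV_s BV_q])
    finally show "b = (\<Sum>i<N. f (real i / N) *\<^sub>C abs_bv (?I i)) + abs_bv (\<lambda>x. f x - s x)"
      unfolding abs_s .
    show "cmod (f (real i / N)) \<le> 3 * norm b" if "i < N" for i
      using norm_le_variation[OF BV_fun_integrable[OF f(1)] var, of "real i / N"] that L1 by auto
    have "ennreal (\<integral>x. cmod (f x - s x) \<partial>leb {0..1}) = (\<integral>\<^sup>+x. cmod (f x - s x) \<partial>leb {0..1})"
      using BV_fun_integrable[OF BV_q] by (intro nn_integral_eq_integral[symmetric] integrable_norm) auto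
    also have "\<dots> \<le> variation {0..1} f * ennreal (1 / N)"
      unfolding s_def using f(1) by (intro nn_integral_step_approximation N) (auto dest: BV_fun_integrable)
    also have "\<dots> \<le> ennreal (norm b + norm b) * ennreal (1 / N)"
      by (intro mult_right_mono var) simp
    also have "\<dots> = ennreal (2 * norm b / N)"
      by (simp flip: ennreal_mult)
    finally show "bv_L1_norm (abs_bv (\<lambda>x. f x - s x)) \<le> 2 * norm b / N"
      by (simp add: bv_L1_norm_abs BV_q ennreal_le_iff)
  qed
qed

section \<open>Operators that regularize integrable functions\<close>

text \<open>
  The powers of \<open>L\<close> are \<open>L\<^sup>1\<close>-contractions and converge to 0 pointwise on elements of
  mean zero.  Since the unit ball of \<open>BV\<close> is up to small \<open>L\<^sup>1\<close> errors spanned by finitely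
  many elements with bounded coefficients, the convergence is uniform on the elements of mean zero
  in that ball.  One more application of \<open>L\<close> turns uniform smallness in \<open>L\<^sup>1\<close> into
  smallness in \<open>BV\<close>, so some power of \<open>L\<close> halves the norm on the kernel of the integral.
\<close>

lemma has_spectral_gap_of_L1_regularization:
  fixes L :: "bv \<Rightarrow> bv"
  assumes add: "\<And>a b. L (a + b) = L a + L b" and scale: "\<And>c b. L (c *\<^sub>C b) = c *\<^sub>C L b"
    and C: "0 \<le> C" and regular: "\<And>b. norm (L b) \<le> C * bv_L1_norm b"
    and contract: "\<And>b. bv_L1_norm (L b) \<le> bv_L1_norm b"
    and inv: "\<And>b. bv_integral (L b) = bv_integral b"
    and conv: "\<And>g. bv_integral g = 0 \<Longrightarrow> (\<lambda>n. bv_L1_norm ((L ^^ n) g)) \<longlonglongrightarrow> 0"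
  shows "has_spectral_gap L"
proof -
  have "bounded_linear L"
  proof (rule bounded_linear_intro)
    show "L (a *\<^sub>R b) = a *\<^sub>R L b" for a b by (simp add: scale flip: scaleC_of_real)
    show "norm (L b) \<le> norm b * C" for b
      using regular[of b] mult_left_mono[OF bv_L1_norm_le_norm C, of b] by (simp add: mult.commute)
  qed (rule add)
  then have L: "bounded_clinear L" by (simp add: bounded_clinear_def scale)
  have Ln: "bounded_clinear (L ^^ n)" for n by (rule bounded_clinear_funpow[OF L])
  have Ln_lin: "linear (L ^^ n)" and Ln_C: "(L ^^ n) (c *\<^sub>C b) = c *\<^sub>C (L ^^ n) b" for n c b
    using Ln[of n] by (auto simp: bounded_clinear_def bounded_linear.linear)
  have Ln_contract: "bv_L1_norm ((L ^^ n) b) \<le> bv_L1_norm b" for n b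
    by (induction n) (auto intro: order_trans[OF contract])
  define u where "u = abs_bv (\<lambda>x. 1)"
  have u: "bv_integral u = 1" "bv_L1_norm u = 1"
    using measure_leb01(2)
    by (simp_all add: u_def bv_integral_abs bv_L1_norm_abs BV_fun_const space_restrict_space)
  \<comment> \<open>With this \<open>N\<close> the remainder of the step approximation contributes at most 1/4.\<close>
  obtain N :: nat where N: "16 * C < N" "0 < N"
    using reals_Archimedean2[of "max (16 * C) 0"] by auto
  define j where "j i = abs_bv (indicator {real i / N..<real (Suc i) / N})" for i
  \<comment> \<open>Cell indicators are corrected by constants, because convergence is known only for mean zero.\<close>
  define e where "e i = j i - bv_integral (j i) *\<^sub>C u" for i
  have int_diff: "bv_integral (a - b) = bv_integral a - bv_integral b" for a b
    using bv_integral_add[of "a - b" b] by simp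
  have "bv_integral (e i) = 0" for i by (simp add: e_def int_diff bv_integral_scaleC u)
  then have "(\<lambda>n. \<Sum>i<N. bv_L1_norm ((L ^^ n) (e i))) \<longlonglongrightarrow> (\<Sum>i<N. 0)"
    by (intro tendsto_sum conv)
  then have "\<forall>\<^sub>F n in sequentially. (\<Sum>i<N. bv_L1_norm ((L ^^ n) (e i))) < 1 / (12 * (C + 1))"
    using C by (intro order_tendstoD(2)) auto
  then obtain n where n: "(\<Sum>i<N. bv_L1_norm ((L ^^ n) (e i))) < 1 / (12 * (C + 1))"
    by (auto simp: eventually_sequentially)
  let ?S = "\<Sum>i<N. bv_L1_norm ((L ^^ n) (e i))"
  have "norm ((L ^^ Suc n) b) \<le> 1/2 * norm b" if b: "bv_integral b = 0" for b
  proof -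
    obtain c q where q: "b = (\<Sum>i<N. c i *\<^sub>C j i) + q"
      and c: "\<And>i. i < N \<Longrightarrow> cmod (c i) \<le> 3 * norm b" and q1: "bv_L1_norm q \<le> 2 * norm b / N"
      unfolding j_def by (rule bv_step_approximation[OF N(2), of b]) blast
    define r where "r = q - bv_integral q *\<^sub>C u"
    \<comment> \<open>As \<open>b\<close> has mean zero, the constants removed from the cell indicators and from \<open>q\<close> cancel.\<close>
    have int_sum: "bv_integral (\<Sum>i<k. c i *\<^sub>C j i) = (\<Sum>i<k. c i * bv_integral (j i))" for k
    proof (induction k)
      case 0
      then show ?case using int_diff[of 0 0] by simp
    qed (simp add: bv_integral_add bv_integral_scaleC)
    have "(\<Sum>i<N. c i * bv_integral (j i)) + bv_integral q = 0"
      using b unfolding q by (simp add: bv_integral_add int_sum)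
    then have int_q: "bv_integral q = - (\<Sum>i<N. c i * bv_integral (j i))"
      by (simp add: add_eq_0_iff2)
    have "(\<Sum>i<N. c i *\<^sub>C e i) = (\<Sum>i<N. c i *\<^sub>C j i) - (\<Sum>i<N. c i * bv_integral (j i)) *\<^sub>C u"
      by (simp add: e_def complex_vector.scale_right_diff_distrib sum_subtractf scaleC_scaleC
          complex_vector.scale_sum_left)
    then have b_eq: "b = (\<Sum>i<N. c i *\<^sub>C e i) + r"
      unfolding q r_def int_q by (simp add: complex_vector.scale_minus_left)
    have "bv_L1_norm r \<le> bv_L1_norm q + bv_L1_norm ((- bv_integral q) *\<^sub>C u)"
      using bv_L1_norm_add[of q "(- bv_integral q) *\<^sub>C u"] by (simp add: r_def complex_vector.scale_minus_left)
    also have "\<dots> \<le> 2 * bv_L1_norm q"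
      unfolding bv_L1_norm_scaleC norm_minus_cancel u using cmod_bv_integral_le[of q] by simp
    finally have r1: "bv_L1_norm r \<le> 4 * norm b / N" using q1 by simp
    have "(L ^^ n) b = (\<Sum>i<N. c i *\<^sub>C (L ^^ n) (e i)) + (L ^^ n) r"
      by (subst b_eq) (simp add: linear_add[OF Ln_lin] linear_sum[OF Ln_lin] Ln_C)
    then have "bv_L1_norm ((L ^^ n) b) \<le> bv_L1_norm (\<Sum>i<N. c i *\<^sub>C (L ^^ n) (e i)) + bv_L1_norm ((L ^^ n) r)"
      by (simp add: bv_L1_norm_add)
    also have "\<dots> \<le> (\<Sum>i<N. bv_L1_norm (c i *\<^sub>C (L ^^ n) (e i))) + bv_L1_norm r"
      by (intro add_mono bv_L1_norm_sum Ln_contract)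
    also have "(\<Sum>i<N. bv_L1_norm (c i *\<^sub>C (L ^^ n) (e i))) \<le> (\<Sum>i<N. 3 * norm b * bv_L1_norm ((L ^^ n) (e i)))"
      unfolding bv_L1_norm_scaleC by (intro sum_mono mult_right_mono c bv_L1_norm_nonneg) simp
    also have "\<dots> = 3 * norm b * ?S" by (simp add: sum_distrib_left)
    finally have "bv_L1_norm ((L ^^ n) b) \<le> (3 * ?S + 4 / N) * norm b"
      using r1 by (simp add: algebra_simps)
    then have "norm ((L ^^ Suc n) b) \<le> C * ((3 * ?S + 4 / N) * norm b)"
      using regular[of "(L ^^ n) b"] mult_left_mono[OF _ C] by (fastforce intro: order_trans)
    also have "\<dots> = (3 * (C * ?S) + 4 * C / N) * norm b" by (simp add: algebra_simps)
    also have "\<dots> \<le> 1/2 * norm b"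
    proof (rule mult_right_mono)
      have "C * ?S \<le> (C + 1) * (1 / (12 * (C + 1)))"
        using n C by (intro mult_mono) (auto intro!: sum_nonneg bv_L1_norm_nonneg)
      also have "\<dots> = 1 / 12" using C by (simp add: field_simps)
      finally have "3 * (C * ?S) \<le> 1 / 4" by simp
      moreover have "4 * C / N \<le> 1 / 4" using N by (simp add: field_simps)
      ultimately show "3 * (C * ?S) + 4 * C / N \<le> 1/2" by linarith
    qed simp
    finally show ?thesis .
  qed
  then show ?thesis
    using cmod_bv_integral_le bv_L1_norm_le_norm
    by (intro has_spectral_gap_of_contracting_kernel[where \<phi> = bv_integral and B = 1 and u = u and m = "Suc n"])
      (auto intro: L inv u bv_integral_add bv_integral_scaleC order_trans)
qed

section \<open>The kernel of the folded noise\<close>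

text \<open>
  Distinct even integers are at distance at least 2, so an even integer within distance 1 of
  \<open>x\<close> is a nearest one.
\<close>

lemma fold01_eq:
  assumes "\<bar>x - 2 * of_int k\<bar> \<le> 1"
  shows "fold01 x = \<bar>x - 2 * of_int k\<bar>"
  unfolding fold01_def
proof (rule antisym)
  show "(INF i::int. \<bar>x - 2 * of_int i\<bar>) \<le> \<bar>x - 2 * of_int k\<bar>"
    by (intro cINF_lower bdd_belowI2[where m = 0]) auto
  show "\<bar>x - 2 * of_int k\<bar> \<le> (INF i::int. \<bar>x - 2 * of_int i\<bar>)"
  proof (rule cINF_greatest)
    fix i :: int
    show "\<bar>x - 2 * of_int k\<bar> \<le> \<bar>x - 2 * of_int i\<bar>"
    proof (cases "i = k")
      case False
      then have "1 \<le> \<bar>i - k\<bar>" by simp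
      then have "1 \<le> \<bar>real_of_int i - of_int k\<bar>" by linarith
      then show ?thesis using assms by linarith
    qed simp
  qed simp
qed

lemma fold01_measurable [measurable]: "fold01 \<in> borel_measurable borel"
  unfolding fold01_def by measurable

lemma pair_sigma_finite_leb: "pair_sigma_finite (leb S) lborel" "pair_sigma_finite (leb S) (leb S')"
  if "S \<in> sets borel" "S' \<in> sets borel" for S S' :: "real set"
  using that
  by (auto intro!: pair_sigma_finite.intro sigma_finite_measure_restrict_space lborel.sigma_finite_measure_axioms)

lemma (in pair_sigma_finite) integrable_product:
  fixes f :: "'a \<Rightarrow> 'c::{banach, second_countable_topology}" and g :: "'b \<Rightarrow> real"
  assumes f: "integrable M1 f" and g: "integrable M2 g"
  shows "integrable (M1 \<Otimes>\<^sub>M M2) (\<lambda>(x, y). g y *\<^sub>R f x)"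
proof -
  have [measurable]: "f \<in> borel_measurable M1" "g \<in> borel_measurable M2"
    using f g by auto
  show ?thesis
  proof (rule Fubini_integrable)
    show "integrable M1 (\<lambda>x. \<integral>y. norm (case (x, y) of (x, y) \<Rightarrow> g y *\<^sub>R f x) \<partial>M2)"
      using f g by simp
  qed (use g in auto)
qed

text \<open>
  The noise density \<open>w\<close> is a pointwise bounded representative on the whole line, so that the
  kernel built from it can be estimated at every point.
\<close>

locale reflected_noise =
  fixes T w :: "real \<Rightarrow> real" and M V :: real
  assumes T_measurable [measurable]: "T \<in> borel_measurable (leb {0..1})"
    and T_range: "\<And>x. x \<in> {0..1} \<Longrightarrow> T x \<in> {0..1}"
    and w_measurable [measurable]: "w \<in> borel_measurable borel"
    and w_nonneg: "\<And>x. 0 \<le> w x" and w_le: "\<And>x. w x \<le> M"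
    and w_support: "\<And>x. x \<notin> {-1..1} \<Longrightarrow> w x = 0"
    and w_integrable: "integrable lborel w" and w_integral: "(\<integral>x. w x \<partial>lborel) = 1"
    and w_variation: "variation UNIV w \<le> ennreal V" and V_nonneg: "0 \<le> V"
begin

text \<open>
  The points of \<open>[-1,2]\<close> that fold to \<open>y\<close> are \<open>y\<close>, \<open>- y\<close> and
  \<open>2 - y\<close>; \<open>fold_kernel t\<close> sums \<open>w (z - t)\<close> over these \<open>z\<close>.
\<close>

definition fold_kernel :: "real \<Rightarrow> real \<Rightarrow> real" where
  "fold_kernel t y = w (y - t) + w (- t - y) + w (2 - t - y)"

definition image_density :: "(real \<Rightarrow> complex) \<Rightarrow> real \<Rightarrow> complex" where
  "image_density f y = (\<integral>x. fold_kernel (T x) y *\<^sub>R f x \<partial>leb {0..1})"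

lemma kernel_nonneg: "0 \<le> fold_kernel t y"
  by (simp add: fold_kernel_def w_nonneg)

lemma kernel_le: "fold_kernel t y \<le> 3 * M"
  unfolding fold_kernel_def using w_le[of "y - t"] w_le[of "- t - y"] w_le[of "2 - t - y"] by simp

lemma M_nonneg: "0 \<le> M"
  using w_nonneg[of 0] w_le[of 0] by simp

lemma kernel_variation: "variation {0..1} (fold_kernel t) \<le> ennreal (3 * V)"
proof -
  have refl: "variation {0..1} (\<lambda>y. w (c - y)) \<le> ennreal V" for c
    using variation_reflect[of "{0..1}" w c] variation_subset[OF subset_UNIV, of "(-) c ` {0..1}" w] w_variation
    by (meson order_trans)
  have shift: "variation {0..1} (\<lambda>y. w (y - t)) \<le> ennreal V"
    using variation_shift[of "{0..1}" w "- t"] w_variation by (simp add: order_trans)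
  have "variation {0..1} (fold_kernel t) \<le> variation {0..1} (\<lambda>y. w (y - t) + w (- t - y)) + variation {0..1} (\<lambda>y. w (2 - t - y))"
    unfolding fold_kernel_def by (rule variation_add)
  also have "\<dots> \<le> (variation {0..1} (\<lambda>y. w (y - t)) + variation {0..1} (\<lambda>y. w (- t - y))) + variation {0..1} (\<lambda>y. w (2 - t - y))"
    by (intro add_mono variation_add order_refl)
  also have "\<dots> \<le> (ennreal V + ennreal V) + ennreal V"
    by (intro add_mono refl shift)
  also have "\<dots> = ennreal (3 * V)" using V_nonneg by (simp flip: ennreal_plus)
  finally show ?thesis .
qed

text \<open>
  For \<open>t\<close> in the unit interval \<open>t + s\<close> ranges over \<open>[-1,2]\<close>, and folding maps each of
  \<open>[-1,0]\<close>, \<open>[0,1]\<close> and \<open>[1,2]\<close> isometrically onto \<open>[0,1]\<close>.  Thus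
  \<open>fold_kernel t\<close> is the density of the folded noise started at \<open>t\<close>.
\<close>

lemma integral_fold_noise:
  assumes A [measurable]: "A \<in> sets borel" and t: "t \<in> {0..1}"
  shows "(\<integral>s. w s * indicator A (fold01 (t + s)) \<partial>lborel) = (\<integral>y. indicator A y * fold_kernel t y \<partial>leb {0..1})"
proof -
  define g where "g z = w (z - t) * indicator A (fold01 z)" for z
  have [measurable]: "g \<in> borel_measurable borel" unfolding g_def by measurable
  have "integrable lborel (\<lambda>z. w (- t + 1 * z))"
    by (rule lborel_integrable_real_affine[OF w_integrable]) simp
  then have "integrable lborel g"
    by (rule Bochner_Integration.integrable_bound) (auto simp: g_def indicator_def)
  then have ig: "integrable lborel (\<lambda>z. indicator B z * g z)" if "B \<in> sets borel" for B
    using that by (rule_tac Bochner_Integration.integrable_bound) (auto simp: indicator_def)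
  have g0: "g z = 0" if "z \<notin> {-1..2}" for z
    using w_support[of "z - t"] that t by (auto simp: g_def)
  \<comment> \<open>The three pieces of \<open>[-1,2]\<close>; their common end points are split off as a null set below.\<close>
  have i1: "(\<integral>z. indicator {-1..<0} z * g z \<partial>lborel)
      = (\<integral>y. indicator {0<..1} y * (indicator A y * w (- t - y)) \<partial>lborel)"
  proof -
    have "(\<integral>z. indicator {-1..<0} z * g z \<partial>lborel) = (\<integral>y. indicator {-1..<0} (0 + (-1) * y) * g (0 + (-1) * y) \<partial>lborel)"
      by (subst lborel_integral_real_affine[where c = "-1" and t = 0]) auto
    also have "\<dots> = (\<integral>y. indicator {0<..1} y * (indicator A y * w (- t - y)) \<partial>lborel)"
    proof (intro Bochner_Integration.integral_cong refl)
      fix y :: real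
      show "indicator {-1..<0} (0 + (-1) * y) * g (0 + (-1) * y) = indicator {0<..1} y * (indicator A y * w (- t - y))"
        using fold01_eq[of "- y" 0] arg_cong[of "- y - t" "- t - y" w] by (auto simp: g_def indicator_def)
    qed
    finally show ?thesis .
  qed
  have i2: "(\<integral>z. indicator {1<..2} z * g z \<partial>lborel)
      = (\<integral>y. indicator {0..<1} y * (indicator A y * w (2 - t - y)) \<partial>lborel)"
  proof -
    have "(\<integral>z. indicator {1<..2} z * g z \<partial>lborel) = (\<integral>y. indicator {1<..2} (2 + (-1) * y) * g (2 + (-1) * y) \<partial>lborel)"
      by (subst lborel_integral_real_affine[where c = "-1" and t = 2]) auto
    also have "\<dots> = (\<integral>y. indicator {0..<1} y * (indicator A y * w (2 - t - y)) \<partial>lborel)"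
    proof (intro Bochner_Integration.integral_cong refl)
      fix y :: real
      show "indicator {1<..2} (2 + (-1) * y) * g (2 + (-1) * y) = indicator {0..<1} y * (indicator A y * w (2 - t - y))"
        using fold01_eq[of "2 - y" 1] by (auto simp: g_def indicator_def algebra_simps)
    qed
    finally show ?thesis .
  qed
  have i0: "(\<integral>z. indicator {0..1} z * g z \<partial>lborel)
      = (\<integral>y. indicator {0..1} y * (indicator A y * w (y - t)) \<partial>lborel)"
  proof (intro Bochner_Integration.integral_cong refl)
    fix y :: real
    show "indicator {0..1} y * g y = indicator {0..1} y * (indicator A y * w (y - t))"
      using fold01_eq[of y 0] by (auto simp: g_def indicator_def)
  qed
  have iw: "integrable lborel (\<lambda>y. indicator B y * (indicator A y * w (c + d * y)))"
    if "B \<in> sets borel" "d \<noteq> 0" for B c d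
    using that
    by (intro Bochner_Integration.integrable_bound[OF lborel_integrable_real_affine[OF w_integrable, of d c]])
      (auto simp: indicator_def)
  have "(\<integral>s. w s * indicator A (fold01 (t + s)) \<partial>lborel) = (\<integral>s. g (t + 1 * s) \<partial>lborel)"
    by (simp add: g_def)
  also have "\<dots> = (\<integral>z. g z \<partial>lborel)"
    by (subst (2) lborel_integral_real_affine[where c = 1 and t = t]) auto
  also have "\<dots> = (\<integral>z. indicator {0..1} z * g z + indicator {-1..<0} z * g z + indicator {1<..2} z * g z \<partial>lborel)"
    by (intro Bochner_Integration.integral_cong refl) (use g0 in \<open>auto simp: indicator_def\<close>)
  also have "\<dots> = (\<integral>z. indicator {0..1} z * g z \<partial>lborel) + (\<integral>z. indicator {-1..<0} z * g z \<partial>lborel)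
      + (\<integral>z. indicator {1<..2} z * g z \<partial>lborel)"
    by (simp add: ig)
  also have "\<dots> = (\<integral>y. indicator {0..1} y * (indicator A y * w (y - t))
      + indicator {0<..1} y * (indicator A y * w (- t - y))
      + indicator {0..<1} y * (indicator A y * w (2 - t - y)) \<partial>lborel)"
    unfolding i0 i1 i2
    using iw[of "{0..1}" 1 "-t"] iw[of "{0<..1}" "-1" "-t"] iw[of "{0..<1}" "-1" "2-t"] by simp
  also have "\<dots> = (\<integral>y. indicator {0..1} y *\<^sub>R (indicator A y * fold_kernel t y) \<partial>lborel)"
  proof (rule integral_cong_AE)
    show "AE y in lborel. indicator {0..1} y * (indicator A y * w (y - t))
        + indicator {0<..1} y * (indicator A y * w (- t - y))
        + indicator {0..<1} y * (indicator A y * w (2 - t - y))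
      = indicator {0..1} y *\<^sub>R (indicator A y * fold_kernel t y)"
      using AE_lborel_singleton[of 0] AE_lborel_singleton[of 1]
      by eventually_elim (auto simp: indicator_def fold_kernel_def)
  qed (auto simp: fold_kernel_def)
  also have "\<dots> = (\<integral>y. indicator A y * fold_kernel t y \<partial>leb {0..1})"
    by (rule integral_restrict_space[symmetric]) simp
  finally show ?thesis .
qed

lemma integral_kernel: "t \<in> {0..1} \<Longrightarrow> (\<integral>y. fold_kernel t y \<partial>leb {0..1}) = 1"
  using integral_fold_noise[of UNIV t] w_integral by simp

text \<open>
  Lets the measurability prover see through the identity from the restricted to the full Borel algebra.
\<close>

lemma id_leb_measurable [measurable]: "(\<lambda>x. x) \<in> borel_measurable (leb S)"
  by (rule measurable_restrict_space1) simp

interpretation unit: pair_sigma_finite "leb {0..1}" "leb {0..1}"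
  by (rule pair_sigma_finite_leb) auto

interpretation noise: pair_sigma_finite "leb {0..1}" "lborel :: real measure"
  by (rule pair_sigma_finite_leb) auto

interpretation leb01: finite_measure "leb {0..1}"
  by (rule measure_leb01)

lemma integrable_kernel:
  assumes [measurable]: "A \<in> sets borel"
  shows "integrable (leb {0..1}) (\<lambda>y. indicator A y * fold_kernel t y)"
  using kernel_nonneg kernel_le M_nonneg
  by (intro leb01.integrable_const_bound[where B = "3 * M"] AE_I2)
    (auto simp: indicator_def fold_kernel_def)

context
  fixes f :: "real \<Rightarrow> complex"
  assumes f: "integrable (leb {0..1}) f"
begin

lemma integrable_kernel_slice: "integrable (leb {0..1}) (\<lambda>x. fold_kernel (T x) y *\<^sub>R f x)"
proof (rule Bochner_Integration.integrable_bound)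
  show "integrable (leb {0..1}) (\<lambda>x. (3 * M) *\<^sub>R f x)" using f by simp
  show "AE x in leb {0..1}. norm (fold_kernel (T x) y *\<^sub>R f x) \<le> norm ((3 * M) *\<^sub>R f x)"
    using kernel_nonneg kernel_le M_nonneg by (intro AE_I2) (auto intro!: mult_right_mono)
  note [measurable] = borel_measurable_integrable[OF f]
  show "(\<lambda>x. fold_kernel (T x) y *\<^sub>R f x) \<in> borel_measurable (leb {0..1})"
    unfolding fold_kernel_def by measurable
qed

lemma integrable_kernel_pair:
  assumes [measurable]: "A \<in> sets borel"
  shows "integrable (leb {0..1} \<Otimes>\<^sub>M leb {0..1}) (\<lambda>(x, y). (indicator A y * fold_kernel (T x) y) *\<^sub>R f x)"
proof (rule Bochner_Integration.integrable_bound)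
  show "integrable (leb {0..1} \<Otimes>\<^sub>M leb {0..1}) (\<lambda>(x, y). (3 * M) *\<^sub>R f x)"
    by (rule unit.integrable_product[OF f]) simp
  show "AE p in leb {0..1} \<Otimes>\<^sub>M leb {0..1}. norm (case p of (x, y) \<Rightarrow> (indicator A y * fold_kernel (T x) y) *\<^sub>R f x)
      \<le> norm (case p of (x, y) \<Rightarrow> (3 * M) *\<^sub>R f x)"
    using kernel_nonneg kernel_le M_nonneg
    by (intro AE_I2) (auto intro!: mult_right_mono simp: indicator_def)
  note [measurable] = borel_measurable_integrable[OF f]
  show "(\<lambda>(x, y). (indicator A y * fold_kernel (T x) y) *\<^sub>R f x) \<in> borel_measurable (leb {0..1} \<Otimes>\<^sub>M leb {0..1})"
    unfolding fold_kernel_def by measurable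
qed

lemma image_density_integrable: "integrable (leb {0..1}) (image_density f)"
  using unit.integrable_snd[OF integrable_kernel_pair[of UNIV]] by (simp add: image_density_def[abs_def])

lemma set_integral_image_density:
  assumes A: "A \<in> sets borel"
  shows "(\<integral>y\<in>A. image_density f y \<partial>leb {0..1})
    = (\<integral>x. (\<integral>y. indicator A y * fold_kernel (T x) y \<partial>leb {0..1}) *\<^sub>R f x \<partial>leb {0..1})"
proof -
  have "(\<integral>y\<in>A. image_density f y \<partial>leb {0..1})
      = (\<integral>y. \<integral>x. (indicator A y * fold_kernel (T x) y) *\<^sub>R f x \<partial>leb {0..1} \<partial>leb {0..1})"
    unfolding set_lebesgue_integral_def image_density_def
    by (simp flip: scaleR_scaleR)
  also have "\<dots> = (\<integral>x. \<integral>y. (indicator A y * fold_kernel (T x) y) *\<^sub>R f x \<partial>leb {0..1} \<partial>leb {0..1})"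
    by (rule unit.Fubini_integral[OF integrable_kernel_pair[OF A]])
  also have "\<dots> = (\<integral>x. (\<integral>y. indicator A y * fold_kernel (T x) y \<partial>leb {0..1}) *\<^sub>R f x \<partial>leb {0..1})"
    by (simp add: integrable_kernel[OF A])
  finally show ?thesis .
qed

lemma integral_image_density: "(\<integral>y. image_density f y \<partial>leb {0..1}) = (\<integral>x. f x \<partial>leb {0..1})"
proof -
  have "(\<integral>y. image_density f y \<partial>leb {0..1}) = (\<integral>x. (\<integral>y. fold_kernel (T x) y \<partial>leb {0..1}) *\<^sub>R f x \<partial>leb {0..1})"
    using set_integral_image_density[of UNIV] by (simp add: set_lebesgue_integral_def)
  also have "\<dots> = (\<integral>x. f x \<partial>leb {0..1})"
    by (intro Bochner_Integration.integral_cong refl) (simp add: space_restrict_space integral_kernel[OF T_range])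
  finally show ?thesis .
qed

lemma norm_image_density_le: "norm (image_density f y) \<le> 3 * M * (\<integral>x. norm (f x) \<partial>leb {0..1})"
proof -
  have "norm (image_density f y) \<le> (\<integral>x. norm (fold_kernel (T x) y *\<^sub>R f x) \<partial>leb {0..1})"
    unfolding image_density_def by (rule integral_norm_bound)
  also have "\<dots> \<le> (\<integral>x. 3 * M * norm (f x) \<partial>leb {0..1})"
    using f integrable_kernel_slice[of y] kernel_nonneg kernel_le
    by (intro integral_mono integrable_norm integrable_mult_right) (auto intro!: mult_right_mono)
  finally show ?thesis by simp
qed

text \<open>
  The variation of an average of kernels is at most the average of their variations, and these are
  bounded uniformly in the base point.  Hence the bound involves only the \<open>L\<^sup>1\<close> norm of
  \<open>f\<close>: the noise regularizes.
\<close>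

lemma variation_image_density:
  "variation {0..1} (image_density f) \<le> ennreal (3 * V * (\<integral>x. norm (f x) \<partial>leb {0..1}))"
  unfolding variation_le_iff
proof (intro allI impI)
  fix n and y :: "nat \<Rightarrow> real"
  assume y: "\<forall>i\<le>n. y i \<in> {0..1}" "\<forall>i<n. y i < y (Suc i)"
  let ?k = "\<lambda>i x. \<bar>fold_kernel (T x) (y i) - fold_kernel (T x) (y (Suc i))\<bar>"
  have int: "integrable (leb {0..1}) (\<lambda>x. ?k i x * norm (f x))" for i
  proof -
    have "integrable (leb {0..1}) (\<lambda>x. norm (fold_kernel (T x) (y i) *\<^sub>R f x - fold_kernel (T x) (y (Suc i)) *\<^sub>R f x))"
      by (intro integrable_norm Bochner_Integration.integrable_diff integrable_kernel_slice)
    then show ?thesis by (simp flip: scaleR_left_diff_distrib)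
  qed
  have "norm (image_density f (y i) - image_density f (y (Suc i))) \<le> (\<integral>x. ?k i x * norm (f x) \<partial>leb {0..1})" for i
  proof -
    have "image_density f (y i) - image_density f (y (Suc i))
        = (\<integral>x. (fold_kernel (T x) (y i) - fold_kernel (T x) (y (Suc i))) *\<^sub>R f x \<partial>leb {0..1})"
      unfolding image_density_def scaleR_left_diff_distrib
      by (rule Bochner_Integration.integral_diff[symmetric, OF integrable_kernel_slice integrable_kernel_slice])
    also have "norm \<dots> \<le> (\<integral>x. norm ((fold_kernel (T x) (y i) - fold_kernel (T x) (y (Suc i))) *\<^sub>R f x) \<partial>leb {0..1})"
      by (rule integral_norm_bound)
    finally show ?thesis by simp
  qed
  then have "(\<Sum>i<n. norm (image_density f (y i) - image_density f (y (Suc i))))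
      \<le> (\<Sum>i<n. \<integral>x. ?k i x * norm (f x) \<partial>leb {0..1})"
    by (rule sum_mono)
  also have "\<dots> = (\<integral>x. (\<Sum>i<n. ?k i x) * norm (f x) \<partial>leb {0..1})"
    unfolding sum_distrib_right by (rule Bochner_Integration.integral_sum[symmetric]) (rule int)
  also have "\<dots> \<le> (\<integral>x. 3 * V * norm (f x) \<partial>leb {0..1})"
  proof (rule integral_mono)
    show "integrable (leb {0..1}) (\<lambda>x. (\<Sum>i<n. ?k i x) * norm (f x))"
      unfolding sum_distrib_right by (intro Bochner_Integration.integrable_sum int)
    show "integrable (leb {0..1}) (\<lambda>x. 3 * V * norm (f x))" using f by simp
    fix x
    have "ennreal (\<Sum>i<n. ?k i x) \<le> ennreal (3 * V)"
      using order_trans[OF variation_sumD[OF y, of "fold_kernel (T x)"] kernel_variation]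
      by (simp flip: sum_ennreal)
    then show "(\<Sum>i<n. ?k i x) * norm (f x) \<le> 3 * V * norm (f x)"
      using V_nonneg by (intro mult_right_mono) (auto simp: ennreal_le_iff)
  qed
  also have "\<dots> = 3 * V * (\<integral>x. norm (f x) \<partial>leb {0..1})" by simp
  finally show "(\<Sum>i<n. ennreal (norm (image_density f (y i) - image_density f (y (Suc i)))))
      \<le> ennreal (3 * V * (\<integral>x. norm (f x) \<partial>leb {0..1}))"
    by (simp add: sum_ennreal ennreal_leI)
qed

lemma BV_image_density: "BV_fun {0..1} (image_density f)"
  using variation_image_density
  by (intro BV_fun_of_variation image_density_integrable) (auto intro: le_less_trans)

lemma bv_norm_image_density:
  "norm (abs_bv (image_density f)) \<le> 3 * (V + M) * (\<integral>x. norm (f x) \<partial>leb {0..1})"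
  using bv_norm_le[OF image_density_integrable variation_image_density _ norm_image_density_le] V_nonneg
  by (simp add: algebra_simps)

lemma pushforward_restrict_integral:
  assumes B: "B \<in> sets borel"
  shows "pushforward {0..1} T (\<lambda>A. if A \<in> sets borel then \<integral>x\<in>A. f x \<partial>leb {0..1} else 0) B
    = (\<integral>x. indicator B (T x) *\<^sub>R f x \<partial>leb {0..1})"
proof -
  have "T -` B \<inter> space (leb {0..1}) \<in> sets (leb {0..1})"
    using T_measurable B by (rule measurable_sets)
  then have "T -` B \<inter> {0..1} \<in> sets borel"
    by (auto simp: space_restrict_space sets_restrict_space)
  then show ?thesis
    using B unfolding pushforward_def set_lebesgue_integral_def
    by (auto intro!: Bochner_Integration.integral_cong simp: space_restrict_space indicator_def)
qed

text \<open>
  The left-hand side is the value at \<open>A\<close> of the folded convolution of the noise with the image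
  under \<open>T\<close> of the measure with density \<open>f\<close>.  By Fubini the noise can be integrated
  first, for a fixed base point \<open>T x\<close>.
\<close>

lemma fold_convolution_integral:
  assumes A [measurable]: "A \<in> sets borel"
  shows "(\<integral>t. w t *\<^sub>R (\<integral>x. indicator A (fold01 (T x + t)) *\<^sub>R f x \<partial>leb {0..1}) \<partial>lborel)
    = (\<integral>y\<in>A. image_density f y \<partial>leb {0..1})"
proof -
  have int: "integrable (leb {0..1} \<Otimes>\<^sub>M lborel) (\<lambda>(x, t). (w t * indicator A (fold01 (T x + t))) *\<^sub>R f x)"
  proof (rule Bochner_Integration.integrable_bound)
    show "integrable (leb {0..1} \<Otimes>\<^sub>M lborel) (\<lambda>(x, t). w t *\<^sub>R f x)"
      by (rule noise.integrable_product[OF f w_integrable])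
    show "AE p in leb {0..1} \<Otimes>\<^sub>M lborel. norm (case p of (x, t) \<Rightarrow> (w t * indicator A (fold01 (T x + t))) *\<^sub>R f x)
      \<le> norm (case p of (x, t) \<Rightarrow> w t *\<^sub>R f x)"
      by (intro AE_I2) (auto simp: indicator_def)
    note [measurable] = borel_measurable_integrable[OF f]
    show "(\<lambda>(x, t). (w t * indicator A (fold01 (T x + t))) *\<^sub>R f x) \<in> borel_measurable (leb {0..1} \<Otimes>\<^sub>M lborel)"
      by measurable
  qed
  have "(\<integral>t. w t *\<^sub>R (\<integral>x. indicator A (fold01 (T x + t)) *\<^sub>R f x \<partial>leb {0..1}) \<partial>lborel)
      = (\<integral>t. \<integral>x. (w t * indicator A (fold01 (T x + t))) *\<^sub>R f x \<partial>leb {0..1} \<partial>lborel)"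
    by (simp flip: scaleR_scaleR)
  also have "\<dots> = (\<integral>x. \<integral>t. (w t * indicator A (fold01 (T x + t))) *\<^sub>R f x \<partial>lborel \<partial>leb {0..1})"
    by (rule noise.Fubini_integral[OF int])
  also have "\<dots> = (\<integral>x. (\<integral>y. indicator A y * fold_kernel (T x) y \<partial>leb {0..1}) *\<^sub>R f x \<partial>leb {0..1})"
  proof (intro Bochner_Integration.integral_cong refl)
    fix x assume "x \<in> space (leb {0..1})"
    then have "T x \<in> {0..1}" by (simp add: space_restrict_space T_range del: atLeastAtMost_iff)
    moreover have "integrable lborel (\<lambda>t. w t * indicator A (fold01 (T x + t)))"
      by (rule Bochner_Integration.integrable_bound[OF w_integrable]) (auto simp: indicator_def)
    ultimately show "(\<integral>t. (w t * indicator A (fold01 (T x + t))) *\<^sub>R f x \<partial>lborel)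
        = (\<integral>y. indicator A y * fold_kernel (T x) y \<partial>leb {0..1}) *\<^sub>R f x"
      by (simp add: integral_fold_noise[OF A])
  qed
  finally show ?thesis by (simp add: set_integral_image_density[OF A])
qed

end

text \<open>
  By positivity of the kernel, the modulus of the image is at most the image of the modulus, which has
  the same integral as the modulus.
\<close>

lemma L1_image_density_le:
  assumes f: "integrable (leb {0..1}) f"
  shows "(\<integral>y. cmod (image_density f y) \<partial>leb {0..1}) \<le> (\<integral>x. cmod (f x) \<partial>leb {0..1})"
proof -
  have nf: "integrable (leb {0..1}) (\<lambda>x. complex_of_real (cmod (f x)))" using f by simp
  have "cmod (image_density f y) \<le> Re (image_density (\<lambda>x. cmod (f x)) y)" for y
  proof -
    have "cmod (image_density f y) \<le> (\<integral>x. norm (fold_kernel (T x) y *\<^sub>R f x) \<partial>leb {0..1})"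
      unfolding image_density_def by (rule integral_norm_bound)
    also have "\<dots> = (\<integral>x. Re (fold_kernel (T x) y *\<^sub>R complex_of_real (cmod (f x))) \<partial>leb {0..1})"
      by (simp add: kernel_nonneg)
    also have "\<dots> = Re (image_density (\<lambda>x. cmod (f x)) y)"
      unfolding image_density_def by (rule integral_Re[OF integrable_kernel_slice[OF nf]])
    finally show ?thesis .
  qed
  then have "(\<integral>y. cmod (image_density f y) \<partial>leb {0..1}) \<le> (\<integral>y. Re (image_density (\<lambda>x. cmod (f x)) y) \<partial>leb {0..1})"
    using image_density_integrable[OF f] image_density_integrable[OF nf] by (intro integral_mono) auto
  also have "\<dots> = Re (\<integral>x. complex_of_real (cmod (f x)) \<partial>leb {0..1})"
    using integral_image_density[OF nf] by (subst integral_Re[OF image_density_integrable[OF nf]]) simp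
  also have "\<dots> = (\<integral>x. cmod (f x) \<partial>leb {0..1})"
    using f by (subst integral_complex_of_real) simp
  finally show ?thesis .
qed

end

section \<open>The transfer operator as an integral operator\<close>

lemma bv_measure_abs:
  "BV_fun {0..1} f \<Longrightarrow> bv_measure (abs_bv f) = (\<lambda>A. if A \<in> sets borel then \<integral>x\<in>A. f x \<partial>leb {0..1} else 0)"
  by (simp add: bv_measure.abs_eq)

lemma bv_measure_inject: "bv_measure a = bv_measure b \<Longrightarrow> a = b"
proof -
  assume eq: "bv_measure a = bv_measure b"
  obtain f g where f: "BV_fun {0..1} f" "a = abs_bv f" and g: "BV_fun {0..1} g" "b = abs_bv g"
    by (metis bv_cases)
  have "(\<integral>x\<in>A. f x \<partial>leb {0..1}) = (\<integral>x\<in>A. g x \<partial>leb {0..1})" if "A \<in> sets (leb {0..1})" for A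
  proof -
    have "A \<in> sets borel" using that by (auto simp: sets_restrict_space)
    then show ?thesis using fun_cong[OF eq, of A] f g by (simp add: bv_measure_abs)
  qed
  then have "AE x in leb {0..1}. f x = g x"
    by (intro sigma_finite_measure.density_unique_banach finite_measure.axioms(1) measure_leb01 BV_fun_integrable f g) auto
  then show "a = b"
    unfolding f(2) g(2) by (rule bv_abs_eqI[OF f(1) g(1)])
qed

context reflected_noise
begin

text \<open>
  The explicit density has the measure that defines the transfer operator, and a class is determined
  by its measure.  Changing \<open>\<rho>\<close> on a null set does not affect the noise measure.
\<close>

lemma transfer_operator_abs:
  assumes f: "BV_fun {0..1} f"
    and \<rho> [measurable]: "\<rho> \<in> borel_measurable (leb {-1..1})"
    and \<rho>w: "AE x in leb {-1..1}. \<rho> x = w x"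
  shows "transfer_operator T \<rho> (abs_bv f) = abs_bv (image_density f)"
proof -
  have fi: "integrable (leb {0..1}) f" by (rule BV_fun_integrable[OF f])
  have [measurable]: "f \<in> borel_measurable (leb {0..1})" using fi by auto
  interpret leb01: sigma_finite_measure "leb {0..1}"
    by (rule sigma_finite_measure_restrict_space) (auto intro: lborel.sigma_finite_measure_axioms)
  let ?\<nu> = "\<lambda>A. if A \<in> sets borel then \<integral>x\<in>A. f x \<partial>leb {0..1} else 0"
  have "transfer_measure T \<rho> (bv_measure (abs_bv f)) A = bv_measure (abs_bv (image_density f)) A" for A
  proof (cases "A \<in> sets borel")
    case A [measurable]: True
    define g where "g t = (\<integral>x. indicator A (fold01 (T x + t)) *\<^sub>R f x \<partial>leb {0..1})" for t
    have [measurable]: "g \<in> borel_measurable borel"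
      unfolding g_def by measurable
    have foldA: "fold01 -` A \<in> sets borel" using measurable_sets[OF fold01_measurable A] by simp
    have shiftA: "{y. fold01 (y + t) \<in> A} \<in> sets borel" for t by measurable
    have "transfer_measure T \<rho> (bv_measure (abs_bv f)) A
        = (\<integral>t. pushforward {0..1} T ?\<nu> {y. fold01 (y + t) \<in> A} \<partial>noise_measure \<rho>)"
      using A foldA by (simp add: transfer_measure_def pushforward_def[of UNIV] conv_measure_def bv_measure_abs f)
    also have "\<dots> = (\<integral>t. g t \<partial>noise_measure \<rho>)"
      unfolding pushforward_restrict_integral[OF fi shiftA] g_def by (simp add: indicator_def)
    also have "\<dots> = (\<integral>t. \<rho> t *\<^sub>R g t \<partial>leb {-1..1})"
      unfolding noise_measure_def using \<rho>w
      by (intro integral_density measurable_restrict_space1 \<rho>) (auto elim!: eventually_mono simp: w_nonneg)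
    also have "\<dots> = (\<integral>t. w t *\<^sub>R g t \<partial>leb {-1..1})"
      using \<rho>w by (intro integral_cong_AE borel_measurable_scaleR measurable_restrict_space1 \<rho>)
        (auto elim!: eventually_mono)
    also have "\<dots> = (\<integral>t. indicator {-1..1} t *\<^sub>R (w t *\<^sub>R g t) \<partial>lborel)"
      by (rule integral_restrict_space) simp
    also have "\<dots> = (\<integral>t. w t *\<^sub>R g t \<partial>lborel)"
      by (intro Bochner_Integration.integral_cong refl) (use w_support in \<open>auto simp: indicator_def\<close>)
    also have "\<dots> = (\<integral>y\<in>A. image_density f y \<partial>leb {0..1})"
      unfolding g_def by (rule fold_convolution_integral[OF fi A])
    finally show ?thesis using A by (simp add: bv_measure_abs BV_image_density[OF fi])
  qed (simp add: transfer_measure_def pushforward_def bv_measure_abs BV_image_density[OF fi])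
  then have eq: "bv_measure (abs_bv (image_density f)) = transfer_measure T \<rho> (bv_measure (abs_bv f))"
    by (simp add: fun_eq_iff)
  show ?thesis
    unfolding transfer_operator_def
    by (rule the_equality[where P = "\<lambda>h. bv_measure h = transfer_measure T \<rho> (bv_measure (abs_bv f))", OF eq])
      (use eq in \<open>auto intro: bv_measure_inject\<close>)
qed

end

text \<open>
  The essential variation is finite, so some representative has finite pointwise variation.  It is
  therefore bounded; its modulus is nonnegative everywhere and still represents the almost
  everywhere nonnegative \<open>\<rho>\<close>, and extension by zero keeps the variation finite.
\<close>

lemma noise_representative:
  assumes BV: "BV_fun {-1..1} \<rho>" and nonneg: "AE x in leb {-1..1}. 0 \<le> \<rho> x"
  obtains w :: "real \<Rightarrow> real" and M V where "w \<in> borel_measurable borel" "\<And>x. 0 \<le> w x" "\<And>x. w x \<le> M"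
    "\<And>x. x \<notin> {-1..1} \<Longrightarrow> w x = 0" "variation UNIV w \<le> ennreal V" "0 \<le> V"
    "AE x in leb {-1..1}. \<rho> x = w x"
proof -
  have "ess_variation {-1..1} \<rho> < top" using BV by (simp add: BV_fun_def)
  then obtain g where g: "g \<in> borel_measurable (leb {-1..1})" "AE x in leb {-1..1}. g x = \<rho> x"
    "variation {-1..1} g < top"
    by (rule ess_variation_less)
  define V where "V = enn2real (variation {-1..1} g)"
  have V: "variation {-1..1} g = ennreal V" "0 \<le> V"
    using g(3) by (simp_all add: V_def enn2real_nonneg less_top)
  define M where "M = norm (g 0) + V"
  define w where "w x = (if x \<in> {-1..1} then norm (g x) else 0)" for x
  have gM: "norm (norm (g x)) \<le> M" if "x \<in> {-1..1}" for x
  proof -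
    have "ennreal (norm (g x - g 0)) \<le> ennreal V"
      unfolding V(1)[symmetric] by (rule norm_diff_le_variation) (use that in auto)
    then have "norm (g x - g 0) \<le> V" using V(2) by (simp add: ennreal_le_iff)
    then show ?thesis unfolding M_def using norm_triangle_sub[of "g x" "g 0"] by simp
  qed
  have M0: "0 \<le> M" using V(2) by (simp add: M_def)
  show thesis
  proof (rule that)
    show "w \<in> borel_measurable borel"
    proof -
      have "(\<lambda>x. norm (g x)) \<in> borel_measurable (leb {-1..1})"
        by (rule measurable_compose[OF g(1) borel_measurable_norm])
      then have "(\<lambda>x. indicator {-1..1} x *\<^sub>R norm (g x)) \<in> borel_measurable lborel"
        by (subst (asm) borel_measurable_restrict_space_iff) auto
      moreover have "(\<lambda>x. indicator {-1..1} x *\<^sub>R norm (g x)) = w"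
        by (auto simp: w_def indicator_def fun_eq_iff)
      ultimately show ?thesis by simp
    qed
    show "0 \<le> w x" for x by (simp add: w_def)
    show "w x \<le> M" for x using gM[of x] M0 by (auto simp: w_def)
    show "w x = 0" if "x \<notin> {-1..1}" for x using that by (auto simp: w_def)
    have "variation UNIV w \<le> variation {-1..1} (\<lambda>x. norm (g x)) + ennreal M + ennreal M"
      unfolding w_def by (rule variation_extend_by_zero[OF gM])
    also have "\<dots> \<le> ennreal V + ennreal M + ennreal M"
      unfolding V(1)[symmetric] by (intro add_mono variation_norm order_refl)
    also have "\<dots> = ennreal (V + M + M)" using V M0 by (simp flip: ennreal_plus)
    finally show "variation UNIV w \<le> ennreal (V + M + M)" .
    show "0 \<le> V + M + M" using V M0 by simp
    show "AE x in leb {-1..1}. \<rho> x = w x"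
      using g(2) nonneg AE_space by eventually_elim (simp add: w_def space_restrict_space)
  qed
qed

theorem proposition79:
  fixes T \<rho> :: "real \<Rightarrow> real"
  assumes T_Borel: "T \<in> leb {0..1} \<rightarrow>\<^sub>M leb {0..1}"
    and T_nonsingular: "nonsingular T"
    and rho_BV: "BV_fun {-1..1} \<rho>"
    and rho_nonneg: "AE x in leb {-1..1}. 0 \<le> \<rho> x"
    and rho_integral: "(\<integral>x. \<rho> x \<partial>leb {-1..1}) = 1"
    and rho_symmetric: "AE x in leb {-1..1}. \<rho> x = \<rho> (- x)"
    and convergence_to_equilibrium:
      "\<And>g :: bv. bv_integral g = 0 \<Longrightarrow>
         (\<lambda>n. bv_L1_norm ((transfer_operator T \<rho> ^^ n) g)) \<longlonglongrightarrow> 0"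
  shows "has_spectral_gap (transfer_operator T \<rho>)"
proof -
  obtain w M V where w: "w \<in> borel_measurable borel" "\<And>x. 0 \<le> w x" "\<And>x. w x \<le> M"
    "\<And>x. x \<notin> {-1..1} \<Longrightarrow> w x = 0" "variation UNIV w \<le> ennreal V" "0 \<le> V"
    "AE x in leb {-1..1}. \<rho> x = w x"
    by (rule noise_representative[OF rho_BV rho_nonneg]) blast
  have \<rho>_int: "integrable (leb {-1..1}) \<rho>" by (rule BV_fun_integrable[OF rho_BV])
  then have \<rho>_meas: "\<rho> \<in> borel_measurable (leb {-1..1})" by auto
  have w_meas: "w \<in> borel_measurable (leb {-1..1})"
    using w(1) by (intro measurable_restrict_space1) simp
  have w_ind: "indicator {-1..1} x *\<^sub>R w x = w x" for x
    using w(4)[of x] by (cases "x \<in> {-1..1}") auto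
  have "integrable (leb {-1..1}) w"
    using \<rho>_int integrable_cong_AE[OF \<rho>_meas w_meas w(7)] by simp
  then have w_int: "integrable lborel w"
    by (subst (asm) integrable_restrict_space) (simp_all only: w_ind, simp)
  have "(\<integral>x. w x \<partial>leb {-1..1}) = 1"
    using rho_integral integral_cong_AE[OF \<rho>_meas w_meas w(7)] by simp
  then have w_integral: "(\<integral>x. w x \<partial>lborel) = 1"
    by (subst (asm) integral_restrict_space) (simp_all only: w_ind, simp)
  have T_range: "T x \<in> {0..1}" if "x \<in> {0..1}" for x
    using measurable_space[OF T_Borel, of x] that by (simp add: space_restrict_space)
  have T_meas: "T \<in> borel_measurable (leb {0..1})"
    using T_Borel by (simp add: measurable_restrict_space2_iff)
  interpret reflected_noise T w M V
    by unfold_locales (fact T_meas T_range w w_int w_integral)+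
  note L_abs = transfer_operator_abs[OF _ \<rho>_meas w(7)]
  show ?thesis
  proof (rule has_spectral_gap_of_L1_regularization[where C = "3 * (V + M)"])
    fix a b :: bv and c :: complex
    obtain f where f: "BV_fun {0..1} f" "a = abs_bv f" by (rule bv_cases)
    obtain g where g: "BV_fun {0..1} g" "b = abs_bv g" by (rule bv_cases)
    note fi = BV_fun_integrable[OF f(1)] and gi = BV_fun_integrable[OF g(1)]
    have "image_density (\<lambda>x. f x + g x) = (\<lambda>y. image_density f y + image_density g y)"
      by (simp add: fun_eq_iff image_density_def scaleR_add_right
          integrable_kernel_slice[OF fi] integrable_kernel_slice[OF gi])
    then show "transfer_operator T \<rho> (a + b) = transfer_operator T \<rho> a + transfer_operator T \<rho> b"
      using f g by (simp add: L_abs BV_fun_add BV_image_density fi gi flip: bv_abs_add)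
    have "image_density (\<lambda>x. c * g x) = (\<lambda>y. c * image_density g y)"
      by (simp add: fun_eq_iff image_density_def flip: mult_scaleR_right)
    then show "transfer_operator T \<rho> (c *\<^sub>C b) = c *\<^sub>C transfer_operator T \<rho> b"
      using g by (simp add: L_abs BV_fun_mult BV_image_density gi bv_scaleC_abs)
    show "0 \<le> 3 * (V + M)" using V_nonneg M_nonneg by simp
    show "norm (transfer_operator T \<rho> b) \<le> 3 * (V + M) * bv_L1_norm b"
      using g bv_norm_image_density[OF gi] by (simp add: L_abs bv_L1_norm_abs)
    show "bv_L1_norm (transfer_operator T \<rho> b) \<le> bv_L1_norm b"
      using g L1_image_density_le[OF gi] by (simp add: L_abs bv_L1_norm_abs BV_image_density gi)
    show "bv_integral (transfer_operator T \<rho> b) = bv_integral b"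
      using g integral_image_density[OF gi] by (simp add: L_abs bv_integral_abs BV_image_density gi)
  qed (rule convergence_to_equilibrium)
qed

end
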